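(* Let $B=\{B(t):t\ge 0\}$ be standard Brownian Motion with $B(0)=0$, let $M(t)=\max_{0\le s\le t}B(s)$, $A(t)=M(t)-B(t)$, $D^+(t)=\sup_{0\le s\le t}A(s)$, and for $d>0$ let $$\mathcal{T}_d^+=\inf\Big\{t\ge 0:\ \sup_{0\le s\le t}A(s)-A(t)\ge d\Big\}.$$ Then for every $c>0$: (i) The stopping time $\mathcal{T}^+_{1/(2c)}$ is optimal for the $c$-problem with reward function $R(t)=D^+(t)$; that is, $E[D^+(\tau)-c\tau]\le E[D^+(\mathcal{T}^+_{1/(2c)})-c\,\mathcal{T}^+_{1/(2c)}]$ for every stopping time $\tau$ with $E[\tau]<\infty$. Moreover, it is the unique optimal stopping time within the family $\{\mathcal{T}^+_d:d>0\}$. (ii) $E[\mathcal{T}^+_{1/(2c)}]=\dfrac{1}{2c^2}$. (iii) The optimal expected payoff is $E[D^+(\mathcal{T}^+_{1/(2c)})-c\,\mathcal{T}^+_{1/(2c)}]=\dfrac{1}{2c}$.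
   Context: $D^+(t)$ is the maximal drawdown of $B$ on $[0,t]$, and $A$ is called the drop process. Stopping times are with respect to the filtration of $B$. Given a reward process $R(t)$ and a cost rate $c>0$, the $c$-problem is the problem of maximizing $E[R(\tau)-c\tau]$ over stopping times $\tau$ of $B$ with $E[\tau]<\infty$; a stopping time is optimal if it attains the maximum. *)

theory Defs
  imports "HOL-Probability.Probability"
begin

text \<open>
  Processes are indexed by \<open>real\<close>, but only times \<open>t \<ge> 0\<close> carry meaning.  All paths (not just almost
  all) are continuous, so that hitting times of closed sets are stopping times of the raw natural
  filtration.
\<close>

locale standard_brownian_motion = prob_space M
  for M :: "'a measure" and B :: "real \<Rightarrow> 'a \<Rightarrow> real" +
  assumes measurable_B: "\<And>t. 0 \<le> t \<Longrightarrow> B t \<in> borel_measurable M"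
    and B_0: "\<And>\<omega>. \<omega> \<in> space M \<Longrightarrow> B 0 \<omega> = 0"
    and continuous_paths: "\<And>\<omega>. \<omega> \<in> space M \<Longrightarrow> continuous_on {0..} (\<lambda>t. B t \<omega>)"
    and normal_increments:
      "\<And>s t. 0 \<le> s \<Longrightarrow> s < t \<Longrightarrow>
        distributed M lborel (\<lambda>\<omega>. B t \<omega> - B s \<omega>) (normal_density 0 (sqrt (t - s)))"
    and indep_increments:
      "\<And>(n::nat) (t::nat \<Rightarrow> real). 0 \<le> t 0 \<Longrightarrow> (\<And>i. i < n \<Longrightarrow> t i < t (Suc i)) \<Longrightarrow>
        indep_vars (\<lambda>_. borel) (\<lambda>i \<omega>. B (t (Suc i)) \<omega> - B (t i) \<omega>) {..<n}"

text \<open>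
  The time index is \<open>ennreal\<close>, so that \<^const>\<open>stopping_time\<close> covers stopping times that may take the
  value \<open>\<infinity>\<close>; the condition it imposes at the index \<open>\<infinity>\<close> is trivially true.
\<close>

definition natural_filtration ::
    "'a measure \<Rightarrow> (real \<Rightarrow> 'a \<Rightarrow> real) \<Rightarrow> ennreal \<Rightarrow> 'a measure" where
  "natural_filtration M B t =
     sigma (space M)
       {B s -` S \<inter> space M | s S. 0 \<le> s \<and> ennreal s \<le> t \<and> S \<in> sets borel}"

definition running_max :: "(real \<Rightarrow> 'a \<Rightarrow> real) \<Rightarrow> real \<Rightarrow> 'a \<Rightarrow> real" where
  "running_max X t \<omega> = (SUP s\<in>{0..t}. X s \<omega>)"

definition drop_process :: "(real \<Rightarrow> 'a \<Rightarrow> real) \<Rightarrow> real \<Rightarrow> 'a \<Rightarrow> real" where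
  "drop_process B t \<omega> = running_max B t \<omega> - B t \<omega>"

definition max_drawdown :: "(real \<Rightarrow> 'a \<Rightarrow> real) \<Rightarrow> real \<Rightarrow> 'a \<Rightarrow> real" where
  "max_drawdown B = running_max (drop_process B)"

definition drop_drawdown_time :: "(real \<Rightarrow> 'a \<Rightarrow> real) \<Rightarrow> real \<Rightarrow> 'a \<Rightarrow> ennreal" where
  "drop_drawdown_time B d \<omega> =
     Inf (ennreal ` {t. 0 \<le> t \<and> (SUP s\<in>{0..t}. drop_process B s \<omega>) - drop_process B t \<omega> \<ge> d})"

definition admissible :: "'a measure \<Rightarrow> (real \<Rightarrow> 'a \<Rightarrow> real) \<Rightarrow> ('a \<Rightarrow> ennreal) \<Rightarrow> bool" where
  "admissible M B \<tau> \<longleftrightarrow>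
     stopping_time (natural_filtration M B) \<tau> \<and> (\<integral>\<^sup>+\<omega>. \<tau> \<omega> \<partial>M) < \<infinity>"

text \<open>
  An admissible \<open>\<tau>\<close> is almost surely finite, so the value of \<^const>\<open>enn2real\<close> at \<open>\<infinity>\<close> is irrelevant.
\<close>

definition net_reward ::
    "(real \<Rightarrow> 'a \<Rightarrow> real) \<Rightarrow> real \<Rightarrow> ('a \<Rightarrow> ennreal) \<Rightarrow> 'a \<Rightarrow> real" where
  "net_reward R c \<tau> \<omega> = R (enn2real (\<tau> \<omega>)) \<omega> - c * enn2real (\<tau> \<omega>)"

text \<open>
  Integrability is part of optimality because the Bochner integral of a non-integrable function is
  0 by convention: the compared expectations have to exist.
\<close>

definition c_optimal ::
    "'a measure \<Rightarrow> (real \<Rightarrow> 'a \<Rightarrow> real) \<Rightarrow> (real \<Rightarrow> 'a \<Rightarrow> real) \<Rightarrow> real \<Rightarrow> ('a \<Rightarrow> ennreal) \<Rightarrow> bool" where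
  "c_optimal M B R c \<tau> \<longleftrightarrow>
     admissible M B \<tau> \<and> integrable M (net_reward R c \<tau>) \<and>
     (\<forall>\<sigma>. admissible M B \<sigma> \<longrightarrow>
        integrable M (net_reward R c \<sigma>) \<and>
        (\<integral>\<omega>. net_reward R c \<sigma> \<omega> \<partial>M) \<le> (\<integral>\<omega>. net_reward R c \<tau> \<omega> \<partial>M))"

end

theory Submission
  imports Defs
begin

text \<open>
  Write \<open>A\<close> for the drop process and \<open>D\<close> for its running maximum.  The drop process behaves like a
  reflected Brownian motion, so \<open>E[A(\<tau>)\<^sup>2] \<le> E[\<tau>]\<close>, and \<open>f(D) (D - A) - F(D)\<close> with \<open>f \<ge> 0\<close>
  nondecreasing and \<open>F' = f\<close> is an Azema--Yor supermartingale.  Taking \<open>f(x) = 2 c (x - d)\<^sup>+\<close> with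
  \<open>d = 1/(2c)\<close> it dominates \<open>D - c A\<^sup>2 - d\<close>, whence \<open>E[D(\<tau>)] \<le> 1/(2c) + c E[\<tau>]\<close> for every admissible
  \<open>\<tau>\<close>.  Both estimates are proved along a grid, where they are pathwise inequalities up to
  martingale differences, and are passed to the limit by Fatou's lemma.

  For the value at \<open>T = \<T>\<^sub>d\<close> let \<open>S\<close> be the first time at which \<open>A\<close> reaches \<open>d\<close>.  Between \<open>S\<close> and \<open>T\<close>
  the maximum of \<open>B\<close> is constant, so \<open>D(T) = 2d + B(S) - B(T)\<close> and \<open>E[D(T)] = 2d\<close> by Wald's
  identity.  On \<open>[0,S]\<close> the drawdown of \<open>B\<close>, and on \<open>[S,T]\<close> that of \<open>-B\<close>, is at most \<open>d\<close>, which
  makes each phase last at most \<open>d\<^sup>2\<close> on average; the converse \<open>E[T] \<ge> 2 d\<^sup>2\<close> is the upper bound for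
  \<open>E[D(T)]\<close> with \<open>c = 1/(2d)\<close>.  Hence \<open>\<T>\<^sub>d\<close> earns \<open>2 d - 2 c d\<^sup>2\<close>, which is maximal exactly at
  \<open>d = 1/(2c)\<close>.
\<close>

section \<open>Running maxima and hitting times of continuous processes\<close>

text \<open>\<open>drop_drawdown_time\<close> is the instance for \<open>D - A\<close>, so both
  phases come under one treatment of first passage. The infimum of the empty set is
  \<open>\<infinity>\<close>, the value when the level is never reached.\<close>

definition hitting_time :: "(real \<Rightarrow> 'a \<Rightarrow> real) \<Rightarrow> real \<Rightarrow> 'a \<Rightarrow> ennreal" where
  "hitting_time X d \<omega> = Inf (ennreal ` {t. 0 \<le> t \<and> d \<le> X t \<omega>})"

lemma running_max_attained:
  assumes "continuous_on {0..} (\<lambda>t. X t \<omega>)" "0 \<le> t"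
  obtains s where "0 \<le> s" "s \<le> t" "running_max X t \<omega> = X s \<omega>"
    "\<And>r. 0 \<le> r \<Longrightarrow> r \<le> t \<Longrightarrow> X r \<omega> \<le> X s \<omega>"
proof -
  have "continuous_on {0..t} (\<lambda>t. X t \<omega>)"
    using assms(1) by (rule continuous_on_subset) auto
  then obtain s where s: "s \<in> {0..t}" "\<And>r. r \<in> {0..t} \<Longrightarrow> X r \<omega> \<le> X s \<omega>"
    using continuous_attains_sup[of "{0..t}" "\<lambda>t. X t \<omega>"] assms(2) by auto
  have "running_max X t \<omega> = X s \<omega>"
    unfolding running_max_def using s by (intro cSup_eq_maximum) auto
  with s show ?thesis by (intro that[of s]) auto
qed

lemma running_max_upper:
  assumes "continuous_on {0..} (\<lambda>t. X t \<omega>)" "0 \<le> s" "s \<le> t"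
  shows "X s \<omega> \<le> running_max X t \<omega>"
  using running_max_attained[of X \<omega> t] assms by (metis order_trans)

lemma running_max_least:
  assumes "0 \<le> t" "\<And>s. 0 \<le> s \<Longrightarrow> s \<le> t \<Longrightarrow> X s \<omega> \<le> C"
  shows "running_max X t \<omega> \<le> C"
  unfolding running_max_def using assms by (intro cSUP_least) auto

lemma running_max_mono:
  assumes "continuous_on {0..} (\<lambda>t. X t \<omega>)" "0 \<le> s" "s \<le> t"
  shows "running_max X s \<omega> \<le> running_max X t \<omega>"
  using assms by (intro running_max_least running_max_upper) auto

lemma running_max_0: "running_max X 0 \<omega> = X 0 \<omega>"
  by (simp add: running_max_def)

text \<open>If \<open>X\<close> varies by less than \<open>e/3\<close> within
  \<open>\<delta>\<close> of \<open>t\<close>, the running maximum gains at most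
  \<open>2 * e / 3\<close> over a step in that window, since every new value is close to one already
  counted.\<close>

lemma continuous_on_running_max:
  assumes X: "continuous_on {0..} (\<lambda>t. X t \<omega>)"
  shows "continuous_on {0..} (\<lambda>t. running_max X t \<omega>)"
  unfolding continuous_on_iff
proof (intro ballI allI impI)
  fix t e :: real assume t: "t \<in> {0..}" and e: "0 < e"
  obtain \<delta> where \<delta>: "\<delta> > 0" "\<And>s. 0 \<le> s \<Longrightarrow> dist s t < \<delta> \<Longrightarrow> dist (X s \<omega>) (X t \<omega>) < e/3"
    using X t e unfolding continuous_on_iff by (metis atLeast_iff divide_pos_pos zero_less_numeral)
  \<comment> \<open>Both one-sided estimates at once: \<open>t\<close> is either the left or the
    right endpoint.\<close>
  have *: "running_max X v \<omega> \<le> running_max X u \<omega> + 2 * e / 3"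
    if uv: "0 \<le> u" "u \<le> v" "dist u t < \<delta>" "dist v t < \<delta>" "t \<in> {u,v}" for u v
  proof (intro running_max_least)
    fix s assume s: "0 \<le> s" "s \<le> v"
    show "X s \<omega> \<le> running_max X u \<omega> + 2 * e / 3"
    proof (cases "s \<le> u")
      case True
      then show ?thesis using running_max_upper[of X \<omega> s u, OF X] s e by simp
    next
      case False
      then have "dist s t < \<delta>" using uv s by (auto simp: dist_real_def)
      then have "dist (X s \<omega>) (X t \<omega>) < e/3" "dist (X u \<omega>) (X t \<omega>) < e/3"
        using \<delta>(2) s uv by auto
      moreover have "X u \<omega> \<le> running_max X u \<omega>"
        using running_max_upper[of X \<omega> u u, OF X] uv by simp
      ultimately show ?thesis by (auto simp: dist_real_def abs_if split: if_splits)
    qed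
  qed (use uv in auto)
  show "\<exists>d>0. \<forall>s\<in>{0..}. dist s t < d \<longrightarrow> dist (running_max X s \<omega>) (running_max X t \<omega>) < e"
  proof (intro exI[of _ \<delta>] conjI ballI impI \<delta>(1))
    fix s :: real assume s: "s \<in> {0..}" "dist s t < \<delta>"
    show "dist (running_max X s \<omega>) (running_max X t \<omega>) < e"
    proof (cases "s \<le> t")
      case True
      then show ?thesis using *[of s t] running_max_mono[of X \<omega> s t, OF X] s t \<delta>(1) e
        by (auto simp: dist_real_def)
    next
      case False
      then show ?thesis using *[of t s] running_max_mono[of X \<omega> t s, OF X] s t \<delta>(1) e
        by (auto simp: dist_real_def)
    qed
  qed
qed

lemma countable_unit_rationals: "countable ({0<..<1} \<inter> \<rat> :: real set)"
  using countable_rat by (rule countable_subset[rotated]) auto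

lemma closure_unit_rationals: "closure ({0<..<1} \<inter> \<rat>) = {0..1::real}"
  using closure_open_Int_superset[of "{0<..<1::real}" "\<rat>"]
  by (simp add: Rats_closure_real)

lemma unit_rationals_nonempty: "{0<..<1} \<inter> \<rat> \<noteq> ({} :: real set)"
  using closure_unit_rationals by (metis atLeastAtMost_iff closure_empty empty_iff order_refl zero_le_one)

text \<open>Reparametrising the interval by proportions \<open>p\<close> lets one countable set
  serve every \<open>t\<close>, including \<open>t = 0\<close>. By continuity the supremum over a
  dense set is the maximum; this yields measurability of running maxima.\<close>

lemma running_max_countable:
  assumes X: "continuous_on {0..} (\<lambda>t. X t \<omega>)" and t: "0 \<le> t"
  shows "running_max X t \<omega> = (SUP p\<in>{0<..<1} \<inter> \<rat>. X (p * t) \<omega>)"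
    and "bdd_above ((\<lambda>p. X (p * t) \<omega>) ` ({0<..<1} \<inter> \<rat>))"
proof -
  have le: "X (p * t) \<omega> \<le> running_max X t \<omega>" if "p \<in> {0<..<1} \<inter> \<rat>" for p
    using that t by (intro running_max_upper X) (auto intro: mult_left_le_one_le)
  then show bdd: "bdd_above ((\<lambda>p. X (p * t) \<omega>) ` ({0<..<1} \<inter> \<rat>))"
    by (intro bdd_aboveI2)
  have cont: "continuous_on {0..1} (\<lambda>p. X (p * t) \<omega>)"
    by (rule continuous_on_compose2[OF X]) (use t in \<open>auto intro!: continuous_intros\<close>)
  have ge: "X (p * t) \<omega> \<le> (SUP p\<in>{0<..<1} \<inter> \<rat>. X (p * t) \<omega>)" if "p \<in> {0..1}" for p
    by (rule continuous_le_on_closure[where S = "{0<..<1} \<inter> \<rat>" and f = "\<lambda>p. X (p * t) \<omega>"])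
      (use cont that bdd in \<open>auto simp: closure_unit_rationals intro!: cSUP_upper\<close>)
  show "running_max X t \<omega> = (SUP p\<in>{0<..<1} \<inter> \<rat>. X (p * t) \<omega>)"
  proof (rule antisym)
    show "running_max X t \<omega> \<le> (SUP p\<in>{0<..<1} \<inter> \<rat>. X (p * t) \<omega>)"
    proof (rule running_max_least[OF t])
      fix s assume s: "0 \<le> s" "s \<le> t"
      show "X s \<omega> \<le> (SUP p\<in>{0<..<1} \<inter> \<rat>. X (p * t) \<omega>)"
      proof (cases "t = 0")
        case True
        then show ?thesis using ge[of 0] s by simp
      next
        case False
        then show ?thesis using ge[of "s / t"] s t by simp
      qed
    qed
    show "(SUP p\<in>{0<..<1} \<inter> \<rat>. X (p * t) \<omega>) \<le> running_max X t \<omega>"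
      using unit_rationals_nonempty le by (intro cSUP_least)
  qed
qed

text \<open>For the forward direction the level is reached before every \<open>u > t\<close>, and
  continuity of the running maximum carries the inequality down to \<open>t\<close>. The event thus
  depends on the path up to \<open>t\<close> alone, as the raw filtration demands.\<close>

lemma hitting_time_le_iff:
  assumes X: "continuous_on {0..} (\<lambda>t. X t \<omega>)" and t: "0 \<le> t"
  shows "hitting_time X d \<omega> \<le> ennreal t \<longleftrightarrow> d \<le> running_max X t \<omega>"
proof
  assume d: "d \<le> running_max X t \<omega>"
  obtain s where "0 \<le> s" "s \<le> t" "running_max X t \<omega> = X s \<omega>"
    using running_max_attained[of X \<omega> t] X t by metis
  then have "hitting_time X d \<omega> \<le> ennreal s"
    using d unfolding hitting_time_def by (intro Inf_lower) auto
  then show "hitting_time X d \<omega> \<le> ennreal t"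
    using \<open>s \<le> t\<close> by (meson ennreal_leI order_trans)
next
  assume le: "hitting_time X d \<omega> \<le> ennreal t"
  show "d \<le> running_max X t \<omega>"
  proof (rule continuous_ge_on_closure[where S = "{t<..}" and f = "\<lambda>u. running_max X u \<omega>"])
    show "continuous_on (closure {t<..}) (\<lambda>u. running_max X u \<omega>)"
      by (rule continuous_on_subset[OF continuous_on_running_max[of X \<omega>, OF X]]) (use t in auto)
    show "t \<in> closure {t<..}" by simp
    fix u assume "u \<in> {t<..}"
    then have "t < u" by simp
    then have "hitting_time X d \<omega> < ennreal u"
      using le t by (meson ennreal_lessI le_less_trans order_le_less_trans)
    then obtain r where r: "0 \<le> r" "d \<le> X r \<omega>" "ennreal r < ennreal u"
      unfolding hitting_time_def Inf_less_iff by auto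
    then have "r \<le> u" by (simp add: ennreal_less_iff)
    then show "d \<le> running_max X u \<omega>"
      using running_max_upper[of X \<omega> r u, OF X] r by auto
  qed
qed

lemma below_before_hitting_time:
  assumes "0 \<le> t" "ennreal t < hitting_time X d \<omega>"
  shows "X t \<omega> < d"
proof (rule ccontr)
  assume "\<not> X t \<omega> < d"
  then have "hitting_time X d \<omega> \<le> ennreal t"
    unfolding hitting_time_def using assms(1) by (intro Inf_lower) auto
  then show False using assms(2) by simp
qed

text \<open>Starting strictly below \<open>d\<close> makes the hitting time positive, so the values
  below \<open>d\<close> to its left give one inequality by continuity; attainment of the running
  maximum gives the other.\<close>

lemma at_hitting_time:
  assumes X: "continuous_on {0..} (\<lambda>t. X t \<omega>)" and T: "0 \<le> T" "hitting_time X d \<omega> = ennreal T"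
    and "X 0 \<omega> < d"
  shows "X T \<omega> = d"
proof -
  have below: "X s \<omega> < d" if "0 \<le> s" "s < T" for s
    using that T by (intro below_before_hitting_time[of s]) (auto intro: ennreal_lessI)
  obtain s where s: "0 \<le> s" "s \<le> T" "running_max X T \<omega> = X s \<omega>"
    using running_max_attained[of X \<omega> T] X T(1) by metis
  have "d \<le> X s \<omega>"
    using hitting_time_le_iff[of X \<omega> T d, OF X T(1)] T(2) s(3) by simp
  then have "s = T" using below[of s] s by fastforce
  then have ge: "d \<le> X T \<omega>" using \<open>d \<le> X s \<omega>\<close> by simp
  then have pos: "0 < T" using assms(4) T(1) by (cases "T = 0") auto
  have "X T \<omega> \<le> d"
  proof (rule continuous_le_on_closure[where S = "{0..<T}" and f = "\<lambda>t. X t \<omega>"])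
    show "continuous_on (closure {0..<T}) (\<lambda>t. X t \<omega>)"
      using pos by (intro continuous_on_subset[OF X]) auto
  qed (use pos below in \<open>auto intro: less_imp_le\<close>)
  with ge show ?thesis by simp
qed

section \<open>The natural filtration, and hitting times as stopping times\<close>

lemma space_natural_filtration [simp]: "space (natural_filtration M B t) = space M"
  unfolding natural_filtration_def by (rule space_measure_of) auto

lemma sets_natural_filtration:
  "sets (natural_filtration M B t) = sigma_sets (space M)
     {B s -` S \<inter> space M | s S. 0 \<le> s \<and> ennreal s \<le> t \<and> S \<in> sets borel}"
  unfolding natural_filtration_def by (rule sets_measure_of) auto

lemma sets_natural_filtration_mono:
  "s \<le> t \<Longrightarrow> sets (natural_filtration M B s) \<subseteq> sets (natural_filtration M B t)"
  unfolding sets_natural_filtration by (rule sigma_sets_mono') (use order_trans in blast)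

lemma measurable_natural_filtration_mono:
  assumes "s \<le> t" "f \<in> measurable (natural_filtration M B s) N"
  shows "f \<in> measurable (natural_filtration M B t) N"
  using assms(2) sets_natural_filtration_mono[OF assms(1), of M B]
  by (auto simp: measurable_def)

lemma process_measurable_natural_filtration:
  assumes "0 \<le> s" "ennreal s \<le> t"
  shows "B s \<in> borel_measurable (natural_filtration M B t)"
  by (rule measurableI) (use assms in \<open>auto simp: sets_natural_filtration\<close>)

definition adapted :: "(ennreal \<Rightarrow> 'a measure) \<Rightarrow> (real \<Rightarrow> 'a \<Rightarrow> real) \<Rightarrow> bool" where
  "adapted F X \<longleftrightarrow> (\<forall>t\<ge>0. X t \<in> borel_measurable (F (ennreal t)))"

lemma adapted_running_max:
  assumes "adapted (natural_filtration M B) X"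
    and "\<And>\<omega>. \<omega> \<in> space M \<Longrightarrow> continuous_on {0..} (\<lambda>t. X t \<omega>)"
  shows "adapted (natural_filtration M B) (running_max X)"
  unfolding adapted_def
proof (intro allI impI)
  fix t :: real assume t: "0 \<le> t"
  let ?F = "natural_filtration M B (ennreal t)"
  have "(\<lambda>\<omega>. SUP p\<in>{0<..<1} \<inter> \<rat>. X (p * t) \<omega>) \<in> borel_measurable ?F"
  proof (intro borel_measurable_cSUP countable_unit_rationals)
    fix p :: real assume "p \<in> {0<..<1} \<inter> \<rat>"
    with t have "0 \<le> p * t" "p * t \<le> t" by (auto intro: mult_left_le_one_le)
    then show "X (p * t) \<in> borel_measurable ?F"
      using assms(1) unfolding adapted_def
      by (auto intro: measurable_natural_filtration_mono[OF ennreal_leI])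
  next
    fix \<omega> assume "\<omega> \<in> space ?F"
    then show "bdd_above ((\<lambda>p. X (p * t) \<omega>) ` ({0<..<1} \<inter> \<rat>))"
      using running_max_countable(2)[of X \<omega> t] assms(2) t by simp
  qed
  also have "?this \<longleftrightarrow> running_max X t \<in> borel_measurable ?F"
  proof (rule measurable_cong)
    fix \<omega> assume "\<omega> \<in> space ?F"
    then show "(SUP p\<in>{0<..<1} \<inter> \<rat>. X (p * t) \<omega>) = running_max X t \<omega>"
      using running_max_countable(1)[of X \<omega> t] assms(2) t by simp
  qed
  finally show "running_max X t \<in> borel_measurable ?F" .
qed

text \<open>At a finite time \<open>r\<close> the event is that the adapted running maximum has
  reached \<open>d\<close>, by \<open>hitting_time_le_iff\<close>; at the index
  \<open>\<infinity>\<close> it is the whole space.\<close>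

lemma stopping_time_hitting_time:
  assumes "adapted (natural_filtration M B) X"
    and "\<And>\<omega>. \<omega> \<in> space M \<Longrightarrow> continuous_on {0..} (\<lambda>t. X t \<omega>)"
  shows "stopping_time (natural_filtration M B) (hitting_time X d)"
proof
  fix t :: ennreal
  show "Measurable.pred (natural_filtration M B t) (\<lambda>\<omega>. hitting_time X d \<omega> \<le> t)"
  proof (cases t)
    case (real r)
    have [measurable]: "running_max X r \<in> borel_measurable (natural_filtration M B t)"
      using adapted_running_max[OF assms] real unfolding adapted_def by simp
    have "Measurable.pred (natural_filtration M B t) (\<lambda>\<omega>. d \<le> running_max X r \<omega>)"
      by measurable
    also have "?this \<longleftrightarrow> ?thesis"
    proof (rule measurable_cong)
      fix \<omega> assume "\<omega> \<in> space (natural_filtration M B t)"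
      then show "(d \<le> running_max X r \<omega>) = (hitting_time X d \<omega> \<le> t)"
        using hitting_time_le_iff[of X \<omega> r d] assms(2)[of \<omega>] real by simp
    qed
    finally show ?thesis .
  qed simp
qed

section \<open>Sampling a continuous process at a random time\<close>

lemma real_nat_ceiling_le: "0 \<le> x \<Longrightarrow> real (nat \<lceil>x\<rceil>) \<le> x + 1" for x :: real
  by linarith

lemma grid_point_LIMSEQ:
  assumes "0 \<le> (t::real)"
  shows "(\<lambda>n. real (nat \<lceil>t * Suc n\<rceil>) / Suc n) \<longlonglongrightarrow> t"
proof (rule real_tendsto_sandwich[where f = "\<lambda>_. t" and h = "\<lambda>n. t + 1 / Suc n"])
  show "\<forall>\<^sub>F n in sequentially. t \<le> real (nat \<lceil>t * Suc n\<rceil>) / Suc n"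
    by (intro always_eventually allI) (simp add: pos_le_divide_eq real_nat_ceiling_ge del: of_nat_Suc)
  have "real (nat \<lceil>t * Suc n\<rceil>) \<le> t * Suc n + 1" for n
    using assms by (intro real_nat_ceiling_le) simp
  then show "\<forall>\<^sub>F n in sequentially. real (nat \<lceil>t * Suc n\<rceil>) / Suc n \<le> t + 1 / Suc n"
    by (intro always_eventually allI) (simp add: pos_divide_le_eq distrib_right del: of_nat_Suc)
  show "(\<lambda>n. t + 1 / Suc n) \<longlonglongrightarrow> t"
    using tendsto_add[OF tendsto_const[of t] LIMSEQ_inverse_real_of_nat] by (simp add: inverse_eq_divide)
qed simp

text \<open>Rounding \<open>T\<close> up to a grid leaves countably many values, on each of which a
  single \<open>X (k / Suc n)\<close> is evaluated. Path continuity makes the result a pointwise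
  limit of measurable functions.\<close>

lemma borel_measurable_at_random_time:
  fixes X :: "real \<Rightarrow> 'a \<Rightarrow> real" and T :: "'a \<Rightarrow> real"
  assumes X: "\<And>t. 0 \<le> t \<Longrightarrow> X t \<in> borel_measurable M"
    and cont: "\<And>\<omega>. \<omega> \<in> space M \<Longrightarrow> continuous_on {0..} (\<lambda>t. X t \<omega>)"
    and T: "T \<in> borel_measurable M" "\<And>\<omega>. \<omega> \<in> space M \<Longrightarrow> (0::real) \<le> T \<omega>"
  shows "(\<lambda>\<omega>. X (T \<omega>) \<omega>) \<in> borel_measurable M"
proof (rule borel_measurable_LIMSEQ_real[where u = "\<lambda>n \<omega>. X (real (nat \<lceil>T \<omega> * Suc n\<rceil>) / Suc n) \<omega>"])
  fix n :: nat
  have [measurable]: "(\<lambda>\<omega>. nat \<lceil>T \<omega> * Suc n\<rceil>) \<in> measurable M (count_space UNIV)"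
  proof (rule measurable_compose[where f = "\<lambda>\<omega>. \<lceil>T \<omega> * Suc n\<rceil>" and g = nat])
    show "(\<lambda>\<omega>. \<lceil>T \<omega> * Suc n\<rceil>) \<in> measurable M (count_space UNIV)"
      using T(1) by measurable
  qed simp
  show "(\<lambda>\<omega>. X (real (nat \<lceil>T \<omega> * Suc n\<rceil>) / Suc n) \<omega>) \<in> borel_measurable M"
    by (rule measurable_compose_countable[where g = "\<lambda>\<omega>. nat \<lceil>T \<omega> * Suc n\<rceil>" and f = "\<lambda>k. X (real k / Suc n)"])
      (auto intro!: X simp del: of_nat_Suc)
next
  fix \<omega> assume \<omega>: "\<omega> \<in> space M"
  show "(\<lambda>n. X (real (nat \<lceil>T \<omega> * Suc n\<rceil>) / Suc n) \<omega>) \<longlonglongrightarrow> X (T \<omega>) \<omega>"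
  proof (rule continuous_on_tendsto_compose[OF cont[OF \<omega>] grid_point_LIMSEQ[OF T(2)[OF \<omega>]]])
    show "\<forall>\<^sub>F n in sequentially. real (nat \<lceil>T \<omega> * Suc n\<rceil>) / Suc n \<in> {0..}"
      unfolding atLeast_iff by (intro always_eventually allI divide_nonneg_nonneg of_nat_0_le_iff)
  qed (use T(2)[OF \<omega>] in simp)
qed

section \<open>Adapted processes and stopping times built from Brownian motion\<close>

context standard_brownian_motion begin

abbreviation \<F> :: "ennreal \<Rightarrow> 'a measure" where
  "\<F> \<equiv> natural_filtration M B"

lemma sets_filtration_subset: "sets (\<F> t) \<subseteq> sets M"
  unfolding sets_natural_filtration
  by (rule sets.sigma_sets_subset) (auto intro: measurable_sets[OF measurable_B])

lemma filtration_measurable: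
  "f \<in> measurable (\<F> t) N \<Longrightarrow> f \<in> measurable M N"
  using sets_filtration_subset[of t] by (auto simp: measurable_def)

lemma stopping_time_measurable:
  assumes "stopping_time \<F> \<tau>"
  shows "\<tau> \<in> borel_measurable M"
  by (rule measurable_stopping_time[OF assms]) (use sets_filtration_subset in auto)

lemma adapted_B: "adapted \<F> B"
  unfolding adapted_def by (auto intro: process_measurable_natural_filtration)

lemma continuous_drop_process:
  assumes "\<omega> \<in> space M"
  shows "continuous_on {0..} (\<lambda>t. drop_process B t \<omega>)"
  unfolding drop_process_def
  using continuous_on_running_max[of B \<omega>] continuous_paths[OF assms]
  by (intro continuous_on_diff) auto

lemma adapted_drop_process: "adapted \<F> (drop_process B)"
  using adapted_running_max[OF adapted_B continuous_paths] adapted_B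
  unfolding adapted_def drop_process_def[abs_def] by (intro allI impI borel_measurable_diff) auto

lemma continuous_max_drawdown:
  assumes "\<omega> \<in> space M"
  shows "continuous_on {0..} (\<lambda>t. max_drawdown B t \<omega>)"
  unfolding max_drawdown_def
  using continuous_on_running_max[of "drop_process B" \<omega>] continuous_drop_process[OF assms] by simp

lemma adapted_max_drawdown: "adapted \<F> (max_drawdown B)"
  unfolding max_drawdown_def by (rule adapted_running_max[OF adapted_drop_process continuous_drop_process])

lemma drop_drawdown_time_eq_hitting_time:
  "drop_drawdown_time B = hitting_time (\<lambda>t \<omega>. max_drawdown B t \<omega> - drop_process B t \<omega>)"
  by (intro ext) (simp add: drop_drawdown_time_def hitting_time_def max_drawdown_def running_max_def)

lemma stopping_time_drop_drawdown_time: "stopping_time \<F> (drop_drawdown_time B d)"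
  unfolding drop_drawdown_time_eq_hitting_time
proof (rule stopping_time_hitting_time)
  show "adapted \<F> (\<lambda>t \<omega>. max_drawdown B t \<omega> - drop_process B t \<omega>)"
    using adapted_max_drawdown adapted_drop_process
    unfolding adapted_def by (intro allI impI borel_measurable_diff) auto
  show "continuous_on {0..} (\<lambda>t. max_drawdown B t \<omega> - drop_process B t \<omega>)"
    if "\<omega> \<in> space M" for \<omega>
    using continuous_max_drawdown[OF that] continuous_drop_process[OF that] by (rule continuous_on_diff)
qed

lemma stopping_time_drop_hitting_time: "stopping_time \<F> (hitting_time (drop_process B) d)"
  by (rule stopping_time_hitting_time[OF adapted_drop_process continuous_drop_process])

section \<open>Independence of the past and Gaussian increments\<close>

text \<open>Independence is given only for successive increments along an increasing sequence. With
  \<open>0 \<in> U\<close> the values at the sorted points of \<open>U\<close> are partial sums of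
  increments up to \<open>s\<close>; with \<open>s \<in> U\<close> the one remaining increment is
  exactly \<open>B t - B s\<close>.\<close>

lemma cylinder_increment_independent:
  assumes U: "finite U" "0 \<in> U" "s \<in> U" "U \<subseteq> {0..s}" and t: "s < t"
    and S: "\<And>u. u \<in> U \<Longrightarrow> S u \<in> sets borel" and A: "A \<in> sets borel"
  shows "prob ({\<omega>\<in>space M. \<forall>u\<in>U. B u \<omega> \<in> S u} \<inter> ((\<lambda>\<omega>. B t \<omega> - B s \<omega>) -` A \<inter> space M)) =
    prob {\<omega>\<in>space M. \<forall>u\<in>U. B u \<omega> \<in> S u} * prob ((\<lambda>\<omega>. B t \<omega> - B s \<omega>) -` A \<inter> space M)"
proof -
  define xs where "xs = sorted_list_of_set U"
  define n where "n = length xs"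
  \<comment> \<open>The points of \<open>U\<close> in increasing order, then \<open>t\<close>: times
    have indices \<open>0\<close> to \<open>n\<close>, increments \<open>0\<close> to
    \<open>n - 1\<close>, and the last increment is \<open>B t - B s\<close>.\<close>
  define ts where "ts i = (xs @ [t]) ! i" for i
  define inc where "inc i \<omega> = B (ts (Suc i)) \<omega> - B (ts i) \<omega>" for i \<omega>
  have set_xs: "set xs = U" using U(1) by (simp add: xs_def)
  have sorted: "sorted_wrt (<) xs" by (simp add: xs_def)
  have n_pos: "0 < n" using U(2) set_xs unfolding n_def by (metis length_pos_if_in_set)
  have ts_nth: "ts i = xs ! i" if "i < n" for i
    using that by (simp add: ts_def n_def nth_append)
  have ts_n: "ts n = t" by (simp add: ts_def n_def)
  have in_U: "ts i \<in> U" if "i < n" for i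
    using that set_xs ts_nth n_def nth_mem by metis
  have less: "ts i < ts j" if "i < j" "j < n" for i j
    using sorted that ts_nth by (simp add: sorted_wrt_iff_nth_less n_def)
  obtain i0 where "i0 < n" "ts i0 = 0"
    using U(2) set_xs ts_nth unfolding n_def by (metis in_set_conv_nth)
  then have ts_0: "ts 0 = 0"
    using less[of 0 i0] in_U[of 0] n_pos U(4) by (cases "i0 = 0") fastforce+
  obtain i1 where i1: "i1 < n" "ts i1 = s"
    using U(3) set_xs ts_nth unfolding n_def by (metis in_set_conv_nth)
  have ts_last: "ts (n - 1) = s"
  proof (cases "i1 = n - 1")
    case False
    then have "s < ts (n - 1)" using less[of i1 "n - 1"] i1 by simp
    then show ?thesis using in_U[of "n - 1"] U(4) n_pos by auto
  qed (use i1 in simp)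
  have step: "ts i < ts (Suc i)" if "i < n" for i
  proof (cases "Suc i < n")
    case False
    then have "i = n - 1" "Suc i = n" using that by auto
    then show ?thesis using ts_last ts_n t by simp
  qed (use less in simp)
  have inc_sum: "B (ts i) \<omega> = (\<Sum>j<i. inc j \<omega>)" if "\<omega> \<in> space M" for i \<omega>
    using sum_lessThan_telescope[of "\<lambda>j. B (ts j) \<omega>" i] ts_0 B_0[OF that] by (simp add: inc_def)
  have last: "inc (n - 1) \<omega> = B t \<omega> - B s \<omega>" for \<omega>
    using n_pos ts_last ts_n by (simp add: inc_def)
  \<comment> \<open>The cylinder in increment coordinates; only increments with index below
    \<open>n - 1\<close> enter.\<close>
  define EA where "EA = {x \<in> space (PiM {..<n - 1} (\<lambda>_. borel :: real measure)).
      \<forall>i\<in>{..<n}. (\<Sum>j<i. x j) \<in> S (ts i)}"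
  define EB where "EB = {x \<in> space (PiM {n - 1} (\<lambda>_. borel :: real measure)). x (n - 1) \<in> A}"
  have "indep_vars (\<lambda>_. borel) inc {..<n}"
    unfolding inc_def using ts_0 step by (intro indep_increments) auto
  from indep_var_restrict[OF this, of "{..<n - 1}" "{n - 1}"]
  have iv: "indep_var (PiM {..<n - 1} (\<lambda>_. borel)) (\<lambda>\<omega>. \<lambda>i\<in>{..<n - 1}. inc i \<omega>)
      (PiM {n - 1} (\<lambda>_. borel)) (\<lambda>\<omega>. \<lambda>i\<in>{n - 1}. inc i \<omega>)"
    using n_pos by auto
  have "EA \<in> sets (PiM {..<n - 1} (\<lambda>_. borel))"
    unfolding EA_def
  proof (intro sets.sets_Collect_finite_All' finite_lessThan)
    fix i assume i: "i \<in> {..<n}"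
    have "(\<lambda>x. \<Sum>j<i. x j) \<in> borel_measurable (PiM {..<n - 1} (\<lambda>_. borel :: real measure))"
      by (intro borel_measurable_sum measurable_component_singleton) (use i in auto)
    from measurable_sets[OF this S[OF in_U]] i
    show "{x \<in> space (PiM {..<n - 1} (\<lambda>_. borel)). (\<Sum>j<i. x j) \<in> S (ts i)}
        \<in> sets (PiM {..<n - 1} (\<lambda>_. borel))"
      by (simp add: vimage_def Int_def conj_commute)
  qed (use n_pos in auto)
  moreover have "EB \<in> sets (PiM {n - 1} (\<lambda>_. borel))"
    unfolding EB_def using A by measurable
  ultimately have "prob ((\<lambda>\<omega>. (\<lambda>i\<in>{..<n - 1}. inc i \<omega>, \<lambda>i\<in>{n - 1}. inc i \<omega>)) -` (EA \<times> EB) \<inter> space M)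
      = prob ((\<lambda>\<omega>. \<lambda>i\<in>{..<n - 1}. inc i \<omega>) -` EA \<inter> space M)
        * prob ((\<lambda>\<omega>. \<lambda>i\<in>{n - 1}. inc i \<omega>) -` EB \<inter> space M)"
    by (rule indep_varD[OF iv])
  moreover have "(\<lambda>\<omega>. \<lambda>i\<in>{n - 1}. inc i \<omega>) -` EB \<inter> space M
      = (\<lambda>\<omega>. B t \<omega> - B s \<omega>) -` A \<inter> space M"
    by (auto simp: EB_def space_PiM last[unfolded One_nat_def])
  moreover have "(\<lambda>\<omega>. \<lambda>i\<in>{..<n - 1}. inc i \<omega>) -` EA \<inter> space M = {\<omega>\<in>space M. \<forall>u\<in>U. B u \<omega> \<in> S u}"
  proof -
    have "(\<Sum>j<i. (\<lambda>i\<in>{..<n - 1}. inc i \<omega>) j) = B (ts i) \<omega>" if "i < n" "\<omega> \<in> space M" for i \<omega>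
      unfolding inc_sum[OF that(2)] using that(1) by (intro sum.cong) auto
    moreover have "(\<forall>u\<in>U. P u) \<longleftrightarrow> (\<forall>i\<in>{..<n}. P (ts i))" for P
      using set_xs ts_nth by (auto simp: n_def all_set_conv_all_nth[of xs P, unfolded set_xs])
    ultimately show ?thesis by (auto simp: EA_def space_PiM)
  qed
  moreover have "(\<lambda>\<omega>. (\<lambda>i\<in>{..<n - 1}. inc i \<omega>, \<lambda>i\<in>{n - 1}. inc i \<omega>)) -` (EA \<times> EB) \<inter> space M
     = ((\<lambda>\<omega>. \<lambda>i\<in>{..<n - 1}. inc i \<omega>) -` EA \<inter> space M) \<inter> ((\<lambda>\<omega>. \<lambda>i\<in>{n - 1}. inc i \<omega>) -` EB \<inter> space M)"
    by auto
  ultimately show ?thesis by simp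
qed

text \<open>Finite-dimensional cylinders up to time \<open>s\<close> form an intersection-stable
  generator of the past, so independence on cylinders extends to the generated
  sigma-algebras.\<close>

lemma indep_set_past_increment:
  assumes "0 \<le> s" "s < t"
  shows "indep_set (sets (\<F> (ennreal s)))
    (sigma_sets (space M) {(\<lambda>\<omega>. B t \<omega> - B s \<omega>) -` A \<inter> space M | A. A \<in> sets borel})"
proof -
  define C where "C = {{\<omega>\<in>space M. \<forall>u\<in>U. B u \<omega> \<in> S u} | U S.
    finite U \<and> U \<subseteq> {0..s} \<and> (\<forall>u\<in>U. S u \<in> sets borel)}"
  let ?G = "{(\<lambda>\<omega>. B t \<omega> - B s \<omega>) -` A \<inter> space M | A. A \<in> sets borel}"
  have diff: "(\<lambda>\<omega>. B t \<omega> - B s \<omega>) \<in> borel_measurable M"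
    using assms by (intro borel_measurable_diff measurable_B) auto
  have C_events: "C \<subseteq> events"
  proof
    fix E assume "E \<in> C"
    then obtain U S where "E = {\<omega>\<in>space M. \<forall>u\<in>U. B u \<omega> \<in> S u}" "finite U" "U \<subseteq> {0..s}"
      "\<And>u. u \<in> U \<Longrightarrow> S u \<in> sets borel"
      unfolding C_def by blast
    moreover from this have "{\<omega>\<in>space M. B u \<omega> \<in> S u} \<in> events" if "u \<in> U" for u
      using measurable_sets[OF measurable_B, of u "S u"] that
      by (force simp: vimage_def Int_def conj_commute)
    ultimately show "E \<in> events" by (auto intro: sets.sets_Collect_finite_All)
  qed
  have "indep_set C ?G"
    unfolding indep_sets2_eq
  proof (intro conjI ballI C_events)
    show "?G \<subseteq> events" using measurable_sets[OF diff] by auto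
    fix E D assume "E \<in> C" "D \<in> ?G"
    then obtain U S A where E: "E = {\<omega>\<in>space M. \<forall>u\<in>U. B u \<omega> \<in> S u}" "finite U" "U \<subseteq> {0..s}"
      "\<And>u. u \<in> U \<Longrightarrow> S u \<in> sets borel"
      and D: "D = (\<lambda>\<omega>. B t \<omega> - B s \<omega>) -` A \<inter> space M" "A \<in> sets borel"
      unfolding C_def by blast
    \<comment> \<open>Adjoining \<open>0\<close> and \<open>s\<close> with the trivial constraint
      \<open>UNIV\<close> brings an arbitrary cylinder into the form required by
      \<open>cylinder_increment_independent\<close>.\<close>
    define S' where "S' u = (if u \<in> U then S u else UNIV)" for u
    have "E = {\<omega>\<in>space M. \<forall>u\<in>insert 0 (insert s U). B u \<omega> \<in> S' u}"
      unfolding E(1) by (auto simp: S'_def)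
    then show "prob (E \<inter> D) = prob E * prob D"
      unfolding D(1)
      by (simp only:, intro cylinder_increment_independent) (use E D assms in \<open>auto simp: S'_def\<close>)
  qed
  moreover have "Int_stable C"
    unfolding Int_stable_def
  proof (intro ballI)
    fix E E' assume "E \<in> C" "E' \<in> C"
    then obtain U S U' S' where
      E: "E = {\<omega>\<in>space M. \<forall>u\<in>U. B u \<omega> \<in> S u}" "finite U" "U \<subseteq> {0..s}" "\<And>u. u \<in> U \<Longrightarrow> S u \<in> sets borel"
      and E': "E' = {\<omega>\<in>space M. \<forall>u\<in>U'. B u \<omega> \<in> S' u}" "finite U'" "U' \<subseteq> {0..s}" "\<And>u. u \<in> U' \<Longrightarrow> S' u \<in> sets borel"
      unfolding C_def by blast
    define R where "R u = (if u \<in> U then S u else UNIV) \<inter> (if u \<in> U' then S' u else UNIV)" for u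
    have "E \<inter> E' = {\<omega>\<in>space M. \<forall>u\<in>U \<union> U'. B u \<omega> \<in> R u}"
      unfolding E(1) E'(1) by (auto simp: R_def)
    moreover have "finite (U \<union> U')" "U \<union> U' \<subseteq> {0..s}" "\<forall>u\<in>U \<union> U'. R u \<in> sets borel"
      using E E' by (auto simp: R_def)
    ultimately show "E \<inter> E' \<in> C" unfolding C_def by blast
  qed
  moreover have "Int_stable ?G"
    unfolding Int_stable_def
  proof (intro ballI)
    fix a b assume "a \<in> ?G" "b \<in> ?G"
    then obtain A A' where "a = (\<lambda>\<omega>. B t \<omega> - B s \<omega>) -` A \<inter> space M"
      "b = (\<lambda>\<omega>. B t \<omega> - B s \<omega>) -` A' \<inter> space M" "A \<in> sets borel" "A' \<in> sets borel" by blast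
    then show "a \<inter> b \<in> ?G" by (intro CollectI exI[of _ "A \<inter> A'"]) auto
  qed
  ultimately have indep: "indep_set (sigma_sets (space M) C) (sigma_sets (space M) ?G)"
    by (rule indep_set_sigma_sets)
  have "sets (\<F> (ennreal s)) \<subseteq> sigma_sets (space M) C"
    unfolding sets_natural_filtration
  proof (rule sigma_sets_mono')
    show "{B u -` S \<inter> space M | u S. 0 \<le> u \<and> ennreal u \<le> ennreal s \<and> S \<in> sets borel} \<subseteq> C"
    proof safe
      fix u :: real and S :: "real set"
      assume u: "0 \<le> u" "ennreal u \<le> ennreal s" and S: "S \<in> sets borel"
      have "B u -` S \<inter> space M = {\<omega>\<in>space M. \<forall>v\<in>{u}. B v \<omega> \<in> S}" by auto
      moreover have "finite {u} \<and> {u} \<subseteq> {0..s} \<and> (\<forall>v\<in>{u}. S \<in> sets borel)"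
        using u S assms by auto
      ultimately show "B u -` S \<inter> space M \<in> C"
        unfolding C_def by (intro CollectI exI[of _ "{u}"] exI[of _ "\<lambda>_. S"]) simp
    qed
  qed
  with indep show ?thesis
    unfolding indep_sets2_eq by blast
qed

lemma indep_var_past_increment:
  assumes "0 \<le> s" "s < t" and H: "H \<in> borel_measurable (\<F> (ennreal s))"
  shows "indep_var borel H borel (\<lambda>\<omega>. B t \<omega> - B s \<omega>)"
  unfolding indep_var_eq
proof (intro conjI)
  show "H \<in> borel_measurable M" by (rule filtration_measurable[OF H])
  show "(\<lambda>\<omega>. B t \<omega> - B s \<omega>) \<in> borel_measurable M"
    using assms by (intro borel_measurable_diff measurable_B) auto
  have "sigma_sets (space M) {H -` A \<inter> space M | A. A \<in> sets borel} \<subseteq> sets (\<F> (ennreal s))"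
    using sets.sigma_sets_subset[of "{H -` A \<inter> space M | A. A \<in> sets borel}" "\<F> (ennreal s)"]
      measurable_sets[OF H] by auto
  then show "indep_set (sigma_sets (space M) {H -` A \<inter> space M | A. A \<in> sets borel})
      (sigma_sets (space M) {(\<lambda>\<omega>. B t \<omega> - B s \<omega>) -` A \<inter> space M | A. A \<in> sets borel})"
    using indep_set_past_increment[OF assms(1,2)] unfolding indep_sets2_eq by blast
qed

text \<open>The fourth moment controls the discretisation error: \<open>n\<close> steps of length
  \<open>h\<close> contribute \<open>3 * n * h\<^sup>2\<close>, which vanishes with the mesh when
  \<open>n * h\<close> is fixed.\<close>

lemma increment_moments:
  assumes "0 \<le> s" "s < t"
  shows "integrable M (\<lambda>\<omega>. (B t \<omega> - B s \<omega>) ^ k)"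
    and "expectation (\<lambda>\<omega>. B t \<omega> - B s \<omega>) = 0"
    and "expectation (\<lambda>\<omega>. (B t \<omega> - B s \<omega>)\<^sup>2) = t - s"
    and "expectation (\<lambda>\<omega>. (B t \<omega> - B s \<omega>) ^ 4) = 3 * (t - s)\<^sup>2"
proof -
  let ?\<sigma> = "sqrt (t - s)"
  have \<sigma>: "0 < ?\<sigma>" "?\<sigma>\<^sup>2 = t - s" using assms by auto
  note D = normal_increments[OF assms]
  show "integrable M (\<lambda>\<omega>. (B t \<omega> - B s \<omega>) ^ k)"
    using distributed_integrable[OF D, of "\<lambda>x. x ^ k"] integrable_normal_moment[OF \<sigma>(1), of 0 k] by simp
  show "expectation (\<lambda>\<omega>. B t \<omega> - B s \<omega>) = 0"
    by (rule normal_distributed_expectation[OF \<sigma>(1) D])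
  show "expectation (\<lambda>\<omega>. (B t \<omega> - B s \<omega>)\<^sup>2) = t - s"
    using distributed_integral[OF D, of "\<lambda>x. x\<^sup>2"] integral_normal_moment_even[OF \<sigma>(1), of 0 1] \<sigma>
    by (simp add: fact_numeral)
  show "expectation (\<lambda>\<omega>. (B t \<omega> - B s \<omega>) ^ 4) = 3 * (t - s)\<^sup>2"
    using distributed_integral[OF D, of "\<lambda>x. x ^ 4"] integral_normal_moment_even[OF \<sigma>(1), of 0 2] \<sigma>
    by (simp add: fact_numeral power_divide)
qed

end

section \<open>Reflected walks with centered steps\<close>

text \<open>Models the increments of \<open>B\<close> or of \<open>-B\<close> on a grid of mesh
  \<open>h\<close>. Conditional moments given the past \<open>G k\<close> are expressed by testing
  against integrable \<open>G k\<close>-measurable \<open>H\<close>. Whether step \<open>k\<close>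
  is taken is decided before the step is seen, so \<open>act\<close> is predictable.\<close>

locale centered_steps = prob_space M for M :: "'a measure" +
  fixes G :: "nat \<Rightarrow> 'a measure" and \<xi> :: "nat \<Rightarrow> 'a \<Rightarrow> real" and h :: real and act :: "nat \<Rightarrow> 'a \<Rightarrow> bool"
  assumes h_pos: "0 < h"
    and space_G: "\<And>k. space (G k) = space M"
    and sets_G: "\<And>k. sets (G k) \<subseteq> sets M"
    and sets_G_Suc: "\<And>k. sets (G k) \<subseteq> sets (G (Suc k))"
    and step_measurable: "\<And>k. \<xi> k \<in> borel_measurable (G (Suc k))"
    and act_measurable: "\<And>k. Measurable.pred (G k) (act k)"
    and integrable_step: "\<And>k H. H \<in> borel_measurable (G k) \<Longrightarrow> integrable M H \<Longrightarrow>
        integrable M (\<lambda>\<omega>. H \<omega> * \<xi> k \<omega>)"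
    and mean_step: "\<And>k H. H \<in> borel_measurable (G k) \<Longrightarrow> integrable M H \<Longrightarrow>
        expectation (\<lambda>\<omega>. H \<omega> * \<xi> k \<omega>) = 0"
    and integrable_step_square: "\<And>k H. H \<in> borel_measurable (G k) \<Longrightarrow> integrable M H \<Longrightarrow>
        integrable M (\<lambda>\<omega>. H \<omega> * (\<xi> k \<omega>)\<^sup>2)"
    and mean_step_square: "\<And>k H. H \<in> borel_measurable (G k) \<Longrightarrow> integrable M H \<Longrightarrow>
        expectation (\<lambda>\<omega>. H \<omega> * (\<xi> k \<omega>)\<^sup>2) = h * expectation H"
    and integrable_step_fourth: "\<And>k. integrable M (\<lambda>\<omega>. \<xi> k \<omega> ^ 4)"
    and mean_step_fourth: "\<And>k. expectation (\<lambda>\<omega>. \<xi> k \<omega> ^ 4) = 3 * h\<^sup>2"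
begin

lemma G_measurable_M: "f \<in> measurable (G k) N \<Longrightarrow> f \<in> measurable M N"
  using sets_G[of k] space_G[of k] by (auto simp: measurable_def)

lemma G_measurable_Suc: "f \<in> measurable (G k) N \<Longrightarrow> f \<in> measurable (G (Suc k)) N"
  using sets_G_Suc[of k] space_G by (auto simp: measurable_def)

definition ind :: "nat \<Rightarrow> 'a \<Rightarrow> real" where
  "ind k \<omega> = (if act k \<omega> then 1 else 0)"

text \<open>The discrete stand-in for the expected duration of a random time interval.\<close>

definition active_time :: "nat \<Rightarrow> real" where
  "active_time n = (\<Sum>k<n. h * expectation (ind k))"

text \<open>Lindley's recursion: \<open>max (a - x) 0\<close> updates the distance of a walk below
  its running maximum when the walk moves by \<open>x\<close>. This is the grid version of
  \<open>A\<close>, frozen during inactive steps, and \<open>peak\<close> is that of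
  \<open>D\<close>.\<close>

fun reflected_walk :: "nat \<Rightarrow> 'a \<Rightarrow> real" where
  "reflected_walk 0 \<omega> = 0"
| "reflected_walk (Suc k) \<omega> =
     (if act k \<omega> then max (reflected_walk k \<omega> - \<xi> k \<omega>) 0 else reflected_walk k \<omega>)"

fun peak :: "nat \<Rightarrow> 'a \<Rightarrow> real" where
  "peak 0 \<omega> = 0"
| "peak (Suc k) \<omega> = max (peak k \<omega>) (reflected_walk (Suc k) \<omega>)"

definition stopped_sum :: "nat \<Rightarrow> 'a \<Rightarrow> real" where
  "stopped_sum n \<omega> = (\<Sum>k<n. ind k \<omega> * \<xi> k \<omega>)"

lemma chi_measurable: "ind k \<in> borel_measurable (G k)"
  using act_measurable[of k] unfolding ind_def[abs_def] by measurable

lemma chi_bounds: "0 \<le> ind k \<omega>" "ind k \<omega> \<le> 1" "\<bar>ind k \<omega>\<bar> \<le> 1"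
  by (auto simp: ind_def)

lemma integrable_chi: "integrable M (ind k)"
  by (rule integrable_const_bound[where B = 1])
    (use chi_bounds G_measurable_M[OF chi_measurable] in auto)

lemma integrable_chi_mult:
  assumes "integrable M f"
  shows "integrable M (\<lambda>\<omega>. ind k \<omega> * f \<omega>)"
proof (rule Bochner_Integration.integrable_bound[OF assms])
  show "(\<lambda>\<omega>. ind k \<omega> * f \<omega>) \<in> borel_measurable M"
    using G_measurable_M[OF chi_measurable] assms by measurable
qed (use chi_bounds(3) in \<open>auto simp: abs_mult intro!: mult_left_le_one_le chi_bounds\<close>)

lemma reflected_walk_measurable: "reflected_walk k \<in> borel_measurable (G k)"
proof (induction k)
  case (Suc k)
  have [measurable]: "Measurable.pred (G (Suc k)) (act k)"
    "reflected_walk k \<in> borel_measurable (G (Suc k))" "\<xi> k \<in> borel_measurable (G (Suc k))"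
    using G_measurable_Suc[OF act_measurable] G_measurable_Suc[OF Suc] step_measurable by auto
  show ?case unfolding reflected_walk.simps[abs_def] by measurable
qed simp

lemma peak_measurable: "peak k \<in> borel_measurable (G k)"
proof (induction k)
  case (Suc k)
  have "peak (Suc k) = (\<lambda>\<omega>. max (peak k \<omega>) (reflected_walk (Suc k) \<omega>))"
    by auto
  then show ?case
    using borel_measurable_max[OF reflected_walk_measurable[of "Suc k"] G_measurable_Suc[OF Suc]]
    by (simp add: max.commute)
qed simp

lemma reflected_walk_nonneg: "0 \<le> reflected_walk k \<omega>"
  by (induction k) auto

lemma reflected_walk_le_peak: "j \<le> k \<Longrightarrow> reflected_walk j \<omega> \<le> peak k \<omega>"
proof (induction k)
  case (Suc k)
  then show ?case by (cases "j = Suc k") (auto simp del: reflected_walk.simps simp: le_max_iff_disj)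
qed simp

lemma peak_nonneg: "0 \<le> peak k \<omega>"
  using reflected_walk_le_peak[of 0 k \<omega>] by simp

lemma step_square_integrable: "integrable M (\<lambda>\<omega>. (\<xi> k \<omega>)\<^sup>2)"
  using integrable_step_square[where k = k and H = "\<lambda>_. 1", OF borel_measurable_const integrable_const]
  unfolding mult_1 .

lemma integrable_reflected_walk_square: "integrable M (\<lambda>\<omega>. (reflected_walk k \<omega>)\<^sup>2)"
proof (induction k)
  case (Suc k)
  have "integrable M (\<lambda>\<omega>. 2 * (reflected_walk k \<omega>)\<^sup>2 + 2 * (\<xi> k \<omega>)\<^sup>2)"
    using Suc step_square_integrable by auto
  then show ?case
  proof (rule Bochner_Integration.integrable_bound)
    show "(\<lambda>\<omega>. (reflected_walk (Suc k) \<omega>)\<^sup>2) \<in> borel_measurable M"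
      using G_measurable_M[OF reflected_walk_measurable[of "Suc k"]] by (rule borel_measurable_power)
    have "(a - x)\<^sup>2 \<le> 2 * a\<^sup>2 + 2 * x\<^sup>2" for a x :: real
      using zero_le_power2[of "a + x"] by (simp add: power2_sum power2_diff)
    then show "AE \<omega> in M. norm ((reflected_walk (Suc k) \<omega>)\<^sup>2) \<le> norm (2 * (reflected_walk k \<omega>)\<^sup>2 + 2 * (\<xi> k \<omega>)\<^sup>2)"
      by (auto simp: max_def)
  qed
qed simp

lemma integrable_reflected_walk: "integrable M (reflected_walk k)"
  by (rule square_integrable_imp_integrable[OF G_measurable_M[OF reflected_walk_measurable]
        integrable_reflected_walk_square])

lemma integrable_peak: "integrable M (peak k)"
proof (induction k)
  case (Suc k)
  have "peak (Suc k) = (\<lambda>\<omega>. max (peak k \<omega>) (reflected_walk (Suc k) \<omega>))" by auto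
  then show ?case using integrable_max[OF Suc integrable_reflected_walk[of "Suc k"]] by simp
qed simp

section \<open>Martingale estimates for the reflected walk\<close>

lemma expectation_chi_step_square: "expectation (\<lambda>\<omega>. ind k \<omega> * (\<xi> k \<omega>)\<^sup>2) = h * expectation (ind k)"
  by (rule mean_step_square[OF chi_measurable integrable_chi])

lemma chi_mult_measurable:
  "f \<in> borel_measurable (G k) \<Longrightarrow> (\<lambda>\<omega>. ind k \<omega> * f \<omega>) \<in> borel_measurable (G k)"
  using chi_measurable by (rule borel_measurable_times)

text \<open>A predictable factor leaves a centered step a martingale difference; this removes the
  linear terms from the pathwise inequalities below.\<close>

lemma chi_step_martingale:
  assumes "f \<in> borel_measurable (G k)" "integrable M f"
  shows "integrable M (\<lambda>\<omega>. ind k \<omega> * f \<omega> * \<xi> k \<omega>)" "expectation (\<lambda>\<omega>. ind k \<omega> * f \<omega> * \<xi> k \<omega>) = 0"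
  by (rule integrable_step mean_step chi_mult_measurable integrable_chi_mult assms)+

text \<open>Reflection at \<open>0\<close> can only decrease the square. Expanding the unreflected
  square leaves a martingale difference and the active part of the squared step.\<close>

lemma expectation_reflected_walk_square_le:
  "expectation (\<lambda>\<omega>. (reflected_walk n \<omega>)\<^sup>2) \<le> active_time n"
proof (induction n)
  case (Suc k)
  let ?a = "reflected_walk k"
  note m = chi_step_martingale[OF reflected_walk_measurable integrable_reflected_walk, of k]
  have "expectation (\<lambda>\<omega>. (reflected_walk (Suc k) \<omega>)\<^sup>2)
      \<le> expectation (\<lambda>\<omega>. (?a \<omega>)\<^sup>2 - 2 * (ind k \<omega> * ?a \<omega> * \<xi> k \<omega>) + ind k \<omega> * (\<xi> k \<omega>)\<^sup>2)"
  proof (rule integral_mono)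
    fix \<omega>
    have "(max (?a \<omega> - \<xi> k \<omega>) 0)\<^sup>2 \<le> (?a \<omega> - \<xi> k \<omega>)\<^sup>2" by (simp add: max_def)
    then show "(reflected_walk (Suc k) \<omega>)\<^sup>2
        \<le> (?a \<omega>)\<^sup>2 - 2 * (ind k \<omega> * ?a \<omega> * \<xi> k \<omega>) + ind k \<omega> * (\<xi> k \<omega>)\<^sup>2"
      by (simp add: ind_def power2_diff)
  qed (use integrable_reflected_walk_square[of "Suc k"] integrable_reflected_walk_square[of k] m(1)
        integrable_chi_mult[OF step_square_integrable] in auto)
  also have "\<dots> = expectation (\<lambda>\<omega>. (?a \<omega>)\<^sup>2) + h * expectation (ind k)"
    using integrable_reflected_walk_square[of k] m integrable_chi_mult[OF step_square_integrable, of k k]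
    by (simp add: expectation_chi_step_square)
  also have "\<dots> \<le> active_time (Suc k)" using Suc by (simp add: active_time_def)
  finally show ?case .
qed (simp add: active_time_def)

text \<open>
  Replacing \<open>a\<^sup>2\<close> by \<open>a\<^sup>2 + \<epsilon> a\<close> makes the overshoot at the reflecting barrier harmless: the linear
  term compensates overshoots below \<open>\<epsilon>\<close>, and fourth moments control the larger ones.
\<close>

lemma active_time_le_expectation_reflected_walk:
  assumes e: "0 < \<epsilon>"
  shows "active_time n \<le> expectation (\<lambda>\<omega>. (reflected_walk n \<omega>)\<^sup>2 + \<epsilon> * reflected_walk n \<omega>) + n * (3 * h\<^sup>2 / \<epsilon>\<^sup>2)"
proof (induction n)
  case (Suc k)
  let ?a = "reflected_walk k"
  note m1 = chi_step_martingale[OF reflected_walk_measurable integrable_reflected_walk, of k]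
  note m2 = chi_step_martingale[where k = k and f = "\<lambda>_. 1", OF borel_measurable_const integrable_const, unfolded mult_1_right]
  have "expectation (\<lambda>\<omega>. ((?a \<omega>)\<^sup>2 + \<epsilon> * ?a \<omega>) - 2 * (ind k \<omega> * ?a \<omega> * \<xi> k \<omega>) - \<epsilon> * (ind k \<omega> * \<xi> k \<omega>)
       + ind k \<omega> * (\<xi> k \<omega>)\<^sup>2 - \<xi> k \<omega> ^ 4 / \<epsilon>\<^sup>2)
    \<le> expectation (\<lambda>\<omega>. (reflected_walk (Suc k) \<omega>)\<^sup>2 + \<epsilon> * reflected_walk (Suc k) \<omega>)"
  proof (rule integral_mono)
    fix \<omega>
    define a where "a = ?a \<omega>"
    define x where "x = \<xi> k \<omega>"
    have a: "0 \<le> a" unfolding a_def by (rule reflected_walk_nonneg)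
    have "(a - x)\<^sup>2 + \<epsilon> * (a - x) - x ^ 4 / \<epsilon>\<^sup>2 \<le> (max (a - x) 0)\<^sup>2 + \<epsilon> * max (a - x) 0"
    proof (cases "a - x \<ge> 0")
      case False
      \<comment> \<open>The part cut off by reflection; it is at most the step itself because
        \<open>a\<close> is nonnegative.\<close>
      define b where "b = x - a"
      have b: "0 < b" "b \<le> x" using False a by (auto simp: b_def)
      have "b\<^sup>2 - \<epsilon> * b \<le> b ^ 4 / \<epsilon>\<^sup>2"
      proof (cases "b \<le> \<epsilon>")
        case True
        then have "b\<^sup>2 \<le> \<epsilon> * b" using b by (simp add: power2_eq_square)
        moreover have "0 \<le> b ^ 4 / \<epsilon>\<^sup>2" by simp
        ultimately show ?thesis by linarith
      next
        case False
        then have "\<epsilon>\<^sup>2 \<le> b\<^sup>2" using e by (intro power_mono) auto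
        then have "b\<^sup>2 * \<epsilon>\<^sup>2 \<le> b\<^sup>2 * b\<^sup>2" by (intro mult_left_mono) auto
        then have "b\<^sup>2 \<le> b ^ 4 / \<epsilon>\<^sup>2" using e by (simp add: pos_le_divide_eq power_add[symmetric])
        then show ?thesis using e b by (smt (verit) mult_pos_pos)
      qed
      also have "\<dots> \<le> x ^ 4 / \<epsilon>\<^sup>2" using b by (intro divide_right_mono power_mono) auto
      finally show ?thesis using False unfolding b_def by (simp add: power2_commute algebra_simps)
    qed simp
    then show "((?a \<omega>)\<^sup>2 + \<epsilon> * ?a \<omega>) - 2 * (ind k \<omega> * ?a \<omega> * \<xi> k \<omega>) - \<epsilon> * (ind k \<omega> * \<xi> k \<omega>)
       + ind k \<omega> * (\<xi> k \<omega>)\<^sup>2 - \<xi> k \<omega> ^ 4 / \<epsilon>\<^sup>2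
      \<le> (reflected_walk (Suc k) \<omega>)\<^sup>2 + \<epsilon> * reflected_walk (Suc k) \<omega>"
      by (auto simp: ind_def power2_diff algebra_simps a_def x_def)
  qed (use integrable_reflected_walk_square[of "Suc k"] integrable_reflected_walk_square[of k]
        integrable_reflected_walk[of "Suc k"] integrable_reflected_walk[of k] m1(1) m2(1)
        integrable_chi_mult[OF step_square_integrable] integrable_step_fourth in \<open>auto simp del: reflected_walk.simps\<close>)
  also have "expectation (\<lambda>\<omega>. ((?a \<omega>)\<^sup>2 + \<epsilon> * ?a \<omega>) - 2 * (ind k \<omega> * ?a \<omega> * \<xi> k \<omega>) - \<epsilon> * (ind k \<omega> * \<xi> k \<omega>)
       + ind k \<omega> * (\<xi> k \<omega>)\<^sup>2 - \<xi> k \<omega> ^ 4 / \<epsilon>\<^sup>2)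
     = expectation (\<lambda>\<omega>. (?a \<omega>)\<^sup>2 + \<epsilon> * ?a \<omega>) + h * expectation (ind k) - 3 * h\<^sup>2 / \<epsilon>\<^sup>2"
    using integrable_reflected_walk_square[of k] integrable_reflected_walk[of k] m1 m2
      integrable_chi_mult[OF step_square_integrable, of k k] integrable_step_fourth
    by (simp add: expectation_chi_step_square mean_step_fourth)
  finally show ?case using Suc
    by (simp add: active_time_def distrib_right add_divide_distrib del: reflected_walk.simps)
qed (simp add: active_time_def)

text \<open>A walk that is at most \<open>d\<close> whenever it is active ends at most one overshoot
  above \<open>d\<close>, so its second moment is about \<open>d\<^sup>2\<close>, and the previous
  lemma turns this into a bound on the active time. The quartic error vanishes with the mesh for
  fixed \<open>\<epsilon>\<close>, and the remaining terms as \<open>\<epsilon>\<close> tends to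
  \<open>0\<close>.\<close>

lemma active_time_le:
  assumes e: "0 < \<epsilon>" and d: "0 \<le> d"
    and bound: "\<And>k \<omega>. \<omega> \<in> space M \<Longrightarrow> act k \<omega> \<Longrightarrow> reflected_walk k \<omega> \<le> d"
  shows "active_time n \<le> d\<^sup>2 + 3 * d * \<epsilon> + 2 * \<epsilon>\<^sup>2 + ((2 * d + \<epsilon>) / \<epsilon> ^ 3 + 2 / \<epsilon>\<^sup>2) * (3 * n * h\<^sup>2)"
proof -
  define C where "C = (2 * d + \<epsilon>) / \<epsilon> ^ 3 + 1 / \<epsilon>\<^sup>2"
  define A where "A = d\<^sup>2 + 3 * d * \<epsilon> + 2 * \<epsilon>\<^sup>2"
  have C: "0 \<le> C" using e d by (simp add: C_def)
  \<comment> \<open>Here \<open>x\<close> is the overshoot of one step. Splitting at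
    \<open>x \<le> \<epsilon>\<close> trades \<open>x\<close> and \<open>x\<^sup>2\<close> for small
    constants plus multiples of \<open>x ^ 4\<close>, whose expectation is under control.\<close>
  have quartic: "(d + x)\<^sup>2 + \<epsilon> * (d + x) \<le> A + C * x ^ 4" if x: "0 \<le> x" for x
  proof -
    have 1: "x \<le> \<epsilon> + x ^ 4 / \<epsilon> ^ 3"
    proof (cases "x \<le> \<epsilon>")
      case False
      then have "x * \<epsilon> ^ 3 \<le> x * x ^ 3" using e by (intro mult_left_mono power_mono) auto
      then have "x \<le> x ^ 4 / \<epsilon> ^ 3" using e by (simp add: pos_le_divide_eq power_eq_if)
      then show ?thesis using e by simp
    qed (use e in \<open>simp add: add_increasing2\<close>)
    have 2: "x\<^sup>2 \<le> \<epsilon>\<^sup>2 + x ^ 4 / \<epsilon>\<^sup>2"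
    proof (cases "x \<le> \<epsilon>")
      case True
      then have "x\<^sup>2 \<le> \<epsilon>\<^sup>2" using x by (intro power_mono) auto
      then show ?thesis by (simp add: add_increasing2)
    next
      case False
      then have "x\<^sup>2 * \<epsilon>\<^sup>2 \<le> x\<^sup>2 * x\<^sup>2" using e by (intro mult_left_mono power_mono) auto
      then have "x\<^sup>2 \<le> x ^ 4 / \<epsilon>\<^sup>2" using e by (simp add: pos_le_divide_eq power_add[symmetric])
      then show ?thesis by (simp add: add_increasing)
    qed
    have "(d + x)\<^sup>2 + \<epsilon> * (d + x) = d\<^sup>2 + \<epsilon> * d + (2 * d + \<epsilon>) * x + x\<^sup>2"
      by (simp add: power2_sum algebra_simps)
    also have "\<dots> \<le> d\<^sup>2 + \<epsilon> * d + (2 * d + \<epsilon>) * (\<epsilon> + x ^ 4 / \<epsilon> ^ 3) + (\<epsilon>\<^sup>2 + x ^ 4 / \<epsilon>\<^sup>2)"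
      using 1 2 d e by (intro add_mono mult_left_mono) auto
    also have "\<dots> = A + C * x ^ 4"
      unfolding A_def C_def by (simp add: algebra_simps add_divide_distrib power2_eq_square)
    finally show ?thesis .
  qed
  \<comment> \<open>The level bound is available only while active, so the last active step may lift
    the walk above \<open>d\<close>, by at most its own size; inactive steps freeze that
    value.\<close>
  have last: "reflected_walk k \<omega> \<le> d \<or> (\<exists>j<k. reflected_walk k \<omega> \<le> d + \<bar>\<xi> j \<omega>\<bar>)"
    if \<omega>: "\<omega> \<in> space M" for k \<omega>
  proof (induction k)
    case (Suc k)
    show ?case
    proof (cases "act k \<omega>")
      case True
      then have "reflected_walk (Suc k) \<omega> \<le> d + \<bar>\<xi> k \<omega>\<bar>" using bound[OF \<omega> True] d by auto
      then show ?thesis by blast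
    next
      case False
      then show ?thesis using Suc by (auto intro: less_SucI)
    qed
  qed (use d in simp)
  have "expectation (\<lambda>\<omega>. (reflected_walk n \<omega>)\<^sup>2 + \<epsilon> * reflected_walk n \<omega>)
      \<le> expectation (\<lambda>\<omega>. A + C * (\<Sum>j<n. \<xi> j \<omega> ^ 4))"
  proof (rule integral_mono)
    fix \<omega> assume \<omega>: "\<omega> \<in> space M"
    \<comment> \<open>The overshooting index is random; the sum over all steps dominates its fourth
      power and has a known expectation.\<close>
    obtain x where x: "0 \<le> x" "reflected_walk n \<omega> \<le> d + x" "x ^ 4 \<le> (\<Sum>j<n. \<xi> j \<omega> ^ 4)"
    proof (cases "reflected_walk n \<omega> \<le> d")
      case True
      then show ?thesis by (intro that[of 0]) (auto intro: sum_nonneg)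
    next
      case False
      then obtain j where "j < n" "reflected_walk n \<omega> \<le> d + \<bar>\<xi> j \<omega>\<bar>" using last[OF \<omega>] by blast
      moreover from this have "\<xi> j \<omega> ^ 4 \<le> (\<Sum>j<n. \<xi> j \<omega> ^ 4)" by (intro member_le_sum) auto
      ultimately show ?thesis by (intro that[of "\<bar>\<xi> j \<omega>\<bar>"]) auto
    qed
    have "(reflected_walk n \<omega>)\<^sup>2 + \<epsilon> * reflected_walk n \<omega> \<le> (d + x)\<^sup>2 + \<epsilon> * (d + x)"
      using x e reflected_walk_nonneg[of n \<omega>] by (intro add_mono mult_left_mono power_mono) auto
    also have "\<dots> \<le> A + C * x ^ 4" by (rule quartic[OF x(1)])
    also have "\<dots> \<le> A + C * (\<Sum>j<n. \<xi> j \<omega> ^ 4)" using x C by (intro add_left_mono mult_left_mono) auto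
    finally show "(reflected_walk n \<omega>)\<^sup>2 + \<epsilon> * reflected_walk n \<omega> \<le> A + C * (\<Sum>j<n. \<xi> j \<omega> ^ 4)" .
  qed (use integrable_reflected_walk_square integrable_reflected_walk integrable_step_fourth in auto)
  also have "\<dots> = A + C * (3 * n * h\<^sup>2)"
    using integrable_step_fourth by (simp add: prob_space mean_step_fourth)
  finally have "active_time n \<le> A + C * (3 * n * h\<^sup>2) + n * (3 * h\<^sup>2 / \<epsilon>\<^sup>2)"
    using active_time_le_expectation_reflected_walk[OF e, of n] by linarith
  also have "\<dots> = A + (C + 1 / \<epsilon>\<^sup>2) * (3 * n * h\<^sup>2)"
    by (simp add: algebra_simps)
  also have "C + 1 / \<epsilon>\<^sup>2 = (2 * d + \<epsilon>) / \<epsilon> ^ 3 + 2 / \<epsilon>\<^sup>2"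
    by (simp add: C_def)
  finally show ?thesis by (simp add: A_def)
qed

text \<open>
  With \<open>f s = 2 c (s - d)\<^sup>+\<close> and its primitive \<open>F s = c ((s - d)\<^sup>+)\<^sup>2\<close>, this is the Azema--Yor
  supermartingale \<open>f(s) (s - a) - F(s)\<close>; it dominates \<open>s - c a\<^sup>2 - d\<close> exactly when \<open>2 c d = 1\<close>.
\<close>

lemma expectation_peak_le:
  assumes c: "0 < c"
  shows "expectation (peak n) \<le> 1 / (2 * c) + c * active_time n"
proof -
  define d where "d = 1 / (2 * c)"
  have cd: "2 * c * d = 1" using c by (simp add: d_def)
  define f where "f s = 2 * c * max 0 (s - d)" for s
  define F where "F s = c * (max 0 (s - d))\<^sup>2" for s
  have f_nonneg: "0 \<le> f s" for s using c by (simp add: f_def)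
  \<comment> \<open>\<open>F\<close> is convex with derivative \<open>f\<close>; this is its tangent
    inequality at \<open>s\<close>.\<close>
  have convex: "F s + f s * (b - s) \<le> F b" for s b
  proof -
    define u v where "u = max 0 (s - d)" and "v = max 0 (b - d)"
    \<comment> \<open>For \<open>s \<le> d\<close> the factor \<open>u\<close> vanishes; otherwise
      \<open>u = s - d\<close>, and \<open>v \<ge> b - d\<close>.\<close>
    have tangent: "u * (b - s) \<le> u * (v - u)"
      unfolding u_def v_def by (auto simp: max_def mult_le_0_iff intro!: mult_left_mono)
    have "c * u\<^sup>2 + 2 * c * (u * (b - s)) \<le> c * u\<^sup>2 + 2 * c * (u * (v - u))"
      using c mult_left_mono[OF tangent, of "2 * c"] by simp
    also have "\<dots> = c * v\<^sup>2 - c * (v - u)\<^sup>2" by (simp add: power2_eq_square algebra_simps)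
    also have "\<dots> \<le> c * v\<^sup>2" using c by simp
    finally show ?thesis by (simp add: F_def f_def u_def v_def mult.assoc)
  qed
  \<comment> \<open>Above \<open>d\<close> the two sides differ by
    \<open>c * (a - (s - d))\<^sup>2\<close> and a term that \<open>2 * c * d = 1\<close>
    annihilates.\<close>
  have dominate: "s - c * a\<^sup>2 \<le> d + (f s * (s - a) - F s)" for s a
  proof (cases "s \<le> d")
    case True
    moreover have "0 \<le> c * a\<^sup>2" using c by simp
    ultimately show ?thesis by (simp add: f_def F_def max_def)
  next
    case False
    have "d + (2 * c * (s - d) * (s - a) - c * (s - d)\<^sup>2) - (s - c * a\<^sup>2)
        = c * (a - (s - d))\<^sup>2 + (2 * c * d - 1) * (s - d)"
      by (simp add: power2_eq_square algebra_simps)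
    also have "\<dots> \<ge> 0" using c cd by simp
    finally show ?thesis using False by (simp add: f_def F_def max_def)
  qed
  \<comment> \<open>\<open>f\<close> is taken at the old peak, known before the step, so
    \<open>P k\<close> is a martingale difference.\<close>
  define P where "P k \<omega> = ind k \<omega> * f (peak k \<omega>) * \<xi> k \<omega>" for k \<omega>
  have f_peak: "(\<lambda>\<omega>. f (peak k \<omega>)) \<in> borel_measurable (G k)" "integrable M (\<lambda>\<omega>. f (peak k \<omega>))" for k
  proof -
    show "(\<lambda>\<omega>. f (peak k \<omega>)) \<in> borel_measurable (G k)"
      using peak_measurable[of k] unfolding f_def by measurable
    show "integrable M (\<lambda>\<omega>. f (peak k \<omega>))"
      unfolding f_def using integrable_peak[of k] by (intro integrable_mult_right integrable_max) auto
  qed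
  have P: "integrable M (P k)" "expectation (P k) = 0" for k
    using chi_step_martingale[OF f_peak] by (auto simp: P_def[abs_def])
  \<comment> \<open>Discrete Azema--Yor inequality. While the peak is unchanged, reflection only
    decreases the left side; at a new peak \<open>s' = a'\<close>, the first term vanishes and the
    tangent inequality of \<open>F\<close> applies.\<close>
  have N: "f (peak n \<omega>) * (peak n \<omega> - reflected_walk n \<omega>) - F (peak n \<omega>) \<le> (\<Sum>k<n. P k \<omega>)" for \<omega>
  proof (induction n)
    case 0
    then show ?case using c by (auto simp: f_def F_def)
  next
    case (Suc n)
    define a s x a' s' where "a = reflected_walk n \<omega>" and "s = peak n \<omega>" and "x = \<xi> n \<omega>"
      and "a' = reflected_walk (Suc n) \<omega>" and "s' = peak (Suc n) \<omega>"
    have s: "a \<le> s" "0 \<le> s" unfolding a_def s_def by (auto intro: reflected_walk_le_peak peak_nonneg)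
    have s': "s' = max s a'" by (simp add: s'_def s_def a'_def)
    have "f s' * (s' - a') - F s' \<le> f s * (s - a) - F s + P n \<omega>"
    proof (cases "act n \<omega>")
      case False
      then have "a' = a" "P n \<omega> = 0" by (auto simp: a'_def a_def P_def ind_def)
      then show ?thesis using s s' by (simp add: max_def)
    next
      case True
      then have a': "a' = max (a - x) 0" and P: "P n \<omega> = f s * x"
        by (auto simp: a'_def a_def x_def s_def P_def ind_def)
      show ?thesis
      proof (cases "a' \<le> s")
        case True
        then have "s' = s" using s' by simp
        have "f s * (s - a') \<le> f s * (s - (a - x))" using a' f_nonneg by (intro mult_left_mono) auto
        then show ?thesis using P \<open>s' = s\<close> by (simp add: algebra_simps)
      next
        case False
        then have eq: "a = a' + x" "s' = a'" using a' s s' by auto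
        show ?thesis using P convex[of s a'] unfolding eq by (simp add: algebra_simps)
      qed
    qed
    then show ?case using Suc by (simp add: a_def s_def a'_def s'_def del: peak.simps reflected_walk.simps)
  qed
  have "expectation (peak n) \<le> expectation (\<lambda>\<omega>. d + c * (reflected_walk n \<omega>)\<^sup>2 + (\<Sum>k<n. P k \<omega>))"
  proof (rule integral_mono)
    fix \<omega>
    show "peak n \<omega> \<le> d + c * (reflected_walk n \<omega>)\<^sup>2 + (\<Sum>k<n. P k \<omega>)"
      using dominate[of "peak n \<omega>" "reflected_walk n \<omega>"] N[of \<omega>] by linarith
  qed (use integrable_peak integrable_reflected_walk_square P in auto)
  also have "\<dots> = d + c * expectation (\<lambda>\<omega>. (reflected_walk n \<omega>)\<^sup>2)"
    using integrable_reflected_walk_square P by (simp add: prob_space)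
  also have "\<dots> \<le> d + c * active_time n"
    using expectation_reflected_walk_square_le c by (intro add_left_mono mult_left_mono) auto
  finally show ?thesis by (simp add: d_def)
qed

section \<open>Discrete Wald identities\<close>

lemma stopped_sum_Suc: "stopped_sum (Suc n) \<omega> = stopped_sum n \<omega> + ind n \<omega> * \<xi> n \<omega>"
  by (simp add: stopped_sum_def)

lemma stopped_sum_measurable: "stopped_sum n \<in> borel_measurable (G n)"
proof (induction n)
  case 0
  then show ?case by (simp add: stopped_sum_def)
next
  case (Suc n)
  have "(\<lambda>\<omega>. stopped_sum n \<omega> + ind n \<omega> * \<xi> n \<omega>) \<in> borel_measurable (G (Suc n))"
    by (intro borel_measurable_add borel_measurable_times G_measurable_Suc chi_measurable step_measurable Suc)
  then show ?case by (simp add: stopped_sum_Suc)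
qed

text \<open>Martingale differences are orthogonal, so the second moment adds up to the active time.
  It provides the uniform bound needed to pass the first identity to the limit.\<close>

lemma stopped_sum_moments:
  shows "integrable M (stopped_sum n)" "expectation (stopped_sum n) = 0"
    and "integrable M (\<lambda>\<omega>. (stopped_sum n \<omega>)\<^sup>2)" "expectation (\<lambda>\<omega>. (stopped_sum n \<omega>)\<^sup>2) = active_time n"
proof -
  have m: "integrable M (\<lambda>\<omega>. ind k \<omega> * \<xi> k \<omega>)" "expectation (\<lambda>\<omega>. ind k \<omega> * \<xi> k \<omega>) = 0" for k
    using chi_step_martingale[where k = k and f = "\<lambda>_. 1", OF borel_measurable_const integrable_const]
    unfolding mult_1_right by auto
  then show 1: "integrable M (stopped_sum n)" for n
    unfolding stopped_sum_def by auto
  show "expectation (stopped_sum n) = 0"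
    unfolding stopped_sum_def using m by simp
  have "integrable M (\<lambda>\<omega>. (stopped_sum n \<omega>)\<^sup>2) \<and> expectation (\<lambda>\<omega>. (stopped_sum n \<omega>)\<^sup>2) = active_time n"
  proof (induction n)
    case 0
    then show ?case by (simp add: stopped_sum_def active_time_def)
  next
    case (Suc n)
    note m2 = chi_step_martingale[OF stopped_sum_measurable 1, of n]
    have *: "(stopped_sum (Suc n) \<omega>)\<^sup>2 = (stopped_sum n \<omega>)\<^sup>2
        + 2 * (ind n \<omega> * stopped_sum n \<omega> * \<xi> n \<omega>) + ind n \<omega> * (\<xi> n \<omega>)\<^sup>2" for \<omega>
      by (simp add: stopped_sum_Suc ind_def power2_sum)
    show ?case
      unfolding * using Suc m2 integrable_chi_mult[OF step_square_integrable, of n n]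
      by (simp add: expectation_chi_step_square active_time_def)
  qed
  then show "integrable M (\<lambda>\<omega>. (stopped_sum n \<omega>)\<^sup>2)" "expectation (\<lambda>\<omega>. (stopped_sum n \<omega>)\<^sup>2) = active_time n"
    by auto
qed

end

section \<open>Passage from the grid to continuous time\<close>

text \<open>Rounding both ends of the interval from \<open>\<sigma>\<close> to \<open>\<rho>\<close>
  up to the grid loses at most one cell. The cut-off at \<open>K\<close> keeps the number of grid
  steps finite.\<close>

lemma grid_occupation_lower:
  fixes N K :: nat and \<sigma> \<rho> :: ennreal
  assumes N: "0 < N"
  shows "enn2real (min \<rho> (ennreal K)) \<le> enn2real (min \<sigma> (ennreal K)) + 1 / N +
    (\<Sum>k<K * N. (1 / N) * (if \<sigma> \<le> ennreal (k / N) \<and> ennreal (k / N) < \<rho> then 1 else 0))"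
proof -
  define r s where "r = enn2real (min \<rho> (ennreal K))" and "s = enn2real (min \<sigma> (ennreal K))"
  have fin: "min \<rho> (ennreal K) < \<infinity>" "min \<sigma> (ennreal K) < \<infinity>"
    by (auto simp: min_less_iff_disj)
  have r: "0 \<le> r" "ennreal r = min \<rho> (ennreal K)" and s: "0 \<le> s" "ennreal s = min \<sigma> (ennreal K)"
    using fin by (auto simp: r_def s_def)
  let ?I = "{nat \<lceil>s * N\<rceil>..<nat \<lceil>r * N\<rceil>}"
  have sub: "k < K * N \<and> \<sigma> \<le> ennreal (k / N) \<and> ennreal (k / N) < \<rho>" if k: "k \<in> ?I" for k
  proof -
    have "s * N \<le> k" using k by (auto simp: nat_le_iff ceiling_le_iff)
    then have sk: "s \<le> k / N" using N by (simp add: pos_le_divide_eq)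
    have "k < r * N" using k r(1) by (auto simp: nat_less_iff zless_nat_eq_int_zless less_ceiling_iff)
    then have kr: "k / N < r" using N by (simp add: pos_divide_less_eq)
    then have "ennreal (k / N) < min \<rho> (ennreal K)"
      unfolding r(2)[symmetric] by (intro ennreal_lessI) (use order.strict_trans1[of 0 "k / N" r] in auto)
    then have 1: "ennreal (k / N) < \<rho>" "ennreal (k / N) < ennreal K" by auto
    then have "k / N < K" by (simp add: ennreal_less_iff)
    then have "real k < real (K * N)" using N by (simp add: pos_divide_less_eq)
    moreover have "min \<sigma> (ennreal K) \<le> ennreal (k / N)"
      unfolding s(2)[symmetric] using sk by (rule ennreal_leI)
    then have "\<sigma> \<le> ennreal (k / N)" using 1(2) unfolding min_le_iff_disj not_le[symmetric] by blast
    ultimately show ?thesis using 1 by (simp only: of_nat_less_iff)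
  qed
  have "r * N - s * N - 1 \<le> real (card ?I)"
  proof -
    \<comment> \<open>Truncated subtraction only enlarges the count, which covers the case that
      \<open>\<rho>\<close> precedes \<open>\<sigma>\<close>.\<close>
    have "real q \<le> real (q - p) + real p" for p q :: nat by linarith
    from this[of "nat \<lceil>r * N\<rceil>" "nat \<lceil>s * N\<rceil>"] show ?thesis
      using s(1) real_nat_ceiling_ge[of "r * N"] real_nat_ceiling_le[of "s * N"]
      unfolding card_atLeastLessThan by (smt (verit) mult_nonneg_nonneg of_nat_0_le_iff)
  qed
  also have "real (card ?I) = (\<Sum>k\<in>?I. 1)" by simp
  also have "\<dots> = (\<Sum>k\<in>?I. if \<sigma> \<le> ennreal (k / N) \<and> ennreal (k / N) < \<rho> then 1 else 0)"
    using sub by (intro sum.cong) auto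
  also have "\<dots> \<le> (\<Sum>k<K * N. if \<sigma> \<le> ennreal (k / N) \<and> ennreal (k / N) < \<rho> then 1 else 0)"
    by (rule sum_mono2) (use sub in auto)
  finally have "(r * N - s * N - 1) / N \<le> (\<Sum>k<K * N. if \<sigma> \<le> ennreal (k / N) \<and> ennreal (k / N) < \<rho> then 1 else 0) / N"
    by (rule divide_right_mono) simp
  moreover have "(r * N - s * N - 1) / N = r - s - 1 / N"
    using N by (simp add: diff_divide_distrib)
  ultimately show ?thesis
    unfolding r_def[symmetric] s_def[symmetric] by (simp add: sum_divide_distrib)
qed

lemma grid_occupation_upper:
  fixes N n :: nat and T :: real
  assumes N: "0 < N" and T: "0 \<le> T"
  shows "(\<Sum>k<n. (1 / N) * (if ennreal (k / N) < ennreal T then 1 else 0)) \<le> T + 1 / N"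
proof -
  have sub: "k < nat \<lceil>T * N\<rceil>" if "ennreal (k / N) < ennreal T" for k
  proof -
    have "k / N < T" using that by (simp add: ennreal_less_iff)
    then have "real k < T * N" using N by (simp add: pos_divide_less_eq)
    then show ?thesis by linarith
  qed
  have "(\<Sum>k<n. if ennreal (k / N) < ennreal T then 1 else 0 :: real)
      \<le> (\<Sum>k<nat \<lceil>T * N\<rceil>. 1)"
    using card_mono[of "{..<nat \<lceil>T * N\<rceil>}" "{k. k < n \<and> ennreal (k / N) < ennreal T}"] sub
    by (subst sum.inter_filter[symmetric]) auto
  also have "\<dots> \<le> T * N + 1" using T N real_nat_ceiling_le[of "T * N"] by simp
  finally have "(\<Sum>k<n. if ennreal (k / N) < ennreal T then 1 else 0 :: real) / N \<le> (T * N + 1) / N"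
    by (rule divide_right_mono) simp
  then show ?thesis using N by (simp add: sum_divide_distrib add_divide_distrib)
qed

text \<open>A second-moment bound provides uniform integrability. Fatou transfers the bound to
  \<open>Y\<close>; the difference \<open>\<bar>Y \<omega> - X n \<omega>\<bar>\<close> truncated at
  \<open>K\<close> vanishes by dominated convergence, and the remainder is of order
  \<open>1 / K\<close>.\<close>

lemma (in prob_space) expectation_zero_LIMSEQ:
  fixes X :: "nat \<Rightarrow> 'a \<Rightarrow> real" and Y :: "'a \<Rightarrow> real"
  assumes X: "\<And>n. X n \<in> borel_measurable M" and X2: "\<And>n. integrable M (\<lambda>\<omega>. (X n \<omega>)\<^sup>2)"
    and mean: "\<And>n. expectation (X n) = 0" and C: "\<And>n. expectation (\<lambda>\<omega>. (X n \<omega>)\<^sup>2) \<le> C"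
    and lim: "AE \<omega> in M. (\<lambda>n. X n \<omega>) \<longlonglongrightarrow> Y \<omega>" and Y: "Y \<in> borel_measurable M"
  shows "integrable M Y" "expectation Y = 0"
proof -
  note [measurable] = X Y
  have C_nonneg: "0 \<le> C" using C[of 0] by (rule order_trans[rotated]) (simp add: integral_nonneg_AE)
  have "(\<integral>\<^sup>+\<omega>. ennreal ((Y \<omega>)\<^sup>2) \<partial>M) = (\<integral>\<^sup>+\<omega>. liminf (\<lambda>n. ennreal ((X n \<omega>)\<^sup>2)) \<partial>M)"
    by (rule nn_integral_cong_AE)
      (use lim in \<open>auto elim!: eventually_mono intro!: lim_imp_Liminf[symmetric] tendsto_ennrealI tendsto_power\<close>)
  also have "\<dots> \<le> liminf (\<lambda>n. \<integral>\<^sup>+\<omega>. ennreal ((X n \<omega>)\<^sup>2) \<partial>M)"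
    by (rule nn_integral_liminf) measurable
  also have "\<dots> \<le> ennreal C"
    by (intro Liminf_le always_eventually allI)
      (use X2 C in \<open>auto simp: nn_integral_eq_integral intro!: ennreal_leI\<close>)
  finally have nnY: "(\<integral>\<^sup>+\<omega>. ennreal ((Y \<omega>)\<^sup>2) \<partial>M) \<le> ennreal C" .
  then have Y2: "integrable M (\<lambda>\<omega>. (Y \<omega>)\<^sup>2)"
    by (intro integrableI_nonneg) (auto simp: le_less_trans)
  then have EY2: "expectation (\<lambda>\<omega>. (Y \<omega>)\<^sup>2) \<le> C"
    using nnY C_nonneg by (simp add: nn_integral_eq_integral)
  show intY: "integrable M Y" by (rule square_integrable_imp_integrable[OF Y Y2])
  have intX: "integrable M (X n)" for n by (rule square_integrable_imp_integrable[OF X X2])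
  \<comment> \<open>The \<open>4 * C\<close> comes from bounding the squared difference by twice the
    sum of the squares, each of second moment at most \<open>C\<close>.\<close>
  have trunc: "\<bar>expectation Y\<bar> \<le> 4 * C / Suc k" for k
  proof (rule LIMSEQ_le_const)
    let ?K = "real (Suc k)"
    let ?m = "\<lambda>n \<omega>. min \<bar>Y \<omega> - X n \<omega>\<bar> ?K"
    have "(\<lambda>n. expectation (?m n)) \<longlonglongrightarrow> expectation (\<lambda>\<omega>. 0)"
    proof (rule integral_dominated_convergence[where w = "\<lambda>_. ?K"])
      show "AE \<omega> in M. (\<lambda>n. ?m n \<omega>) \<longlonglongrightarrow> 0"
        using lim
      proof eventually_elim
        case (elim \<omega>)
        then have "(\<lambda>n. ?m n \<omega>) \<longlonglongrightarrow> min \<bar>Y \<omega> - Y \<omega>\<bar> ?K"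
          by (intro tendsto_intros)
        then show ?case by simp
      qed
    qed auto
    then show "(\<lambda>n. expectation (?m n) + 4 * C / ?K) \<longlonglongrightarrow> 4 * C / ?K"
      using tendsto_add[of _ 0 sequentially "\<lambda>_. 4 * C / ?K"] by fastforce
    have "\<bar>expectation Y\<bar> \<le> expectation (?m n) + 4 * C / ?K" for n
    proof -
      have intm: "integrable M (?m n)"
        by (rule integrable_const_bound[where B = ?K]) auto
      have pw: "\<bar>Y \<omega> - X n \<omega>\<bar> \<le> ?m n \<omega> + (2 * (Y \<omega>)\<^sup>2 + 2 * (X n \<omega>)\<^sup>2) / ?K" for \<omega>
      proof -
        define z where "z = \<bar>Y \<omega> - X n \<omega>\<bar>"
        have "z\<^sup>2 \<le> 2 * (Y \<omega>)\<^sup>2 + 2 * (X n \<omega>)\<^sup>2"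
          using zero_le_power2[of "Y \<omega> + X n \<omega>"] by (simp add: z_def power2_sum power2_diff)
        then have "z\<^sup>2 / ?K \<le> (2 * (Y \<omega>)\<^sup>2 + 2 * (X n \<omega>)\<^sup>2) / ?K"
          by (intro divide_right_mono) auto
        moreover have "z \<le> min z ?K + z\<^sup>2 / ?K"
        proof (cases "z \<le> ?K")
          case False
          then have "z * ?K \<le> z * z" by (intro mult_left_mono) (auto simp: z_def)
          then have "z \<le> z\<^sup>2 / ?K" by (simp add: pos_le_divide_eq power2_eq_square)
          then show ?thesis using False by simp
        qed simp
        ultimately show ?thesis unfolding z_def by linarith
      qed
      have "expectation Y = expectation (\<lambda>\<omega>. Y \<omega> - X n \<omega>)"
        using intY intX mean by simp
      then have "\<bar>expectation Y\<bar> \<le> expectation (\<lambda>\<omega>. \<bar>Y \<omega> - X n \<omega>\<bar>)"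
        using integral_abs_bound[of M "\<lambda>\<omega>. Y \<omega> - X n \<omega>"] by simp
      also have "\<dots> \<le> expectation (\<lambda>\<omega>. ?m n \<omega> + (2 * (Y \<omega>)\<^sup>2 + 2 * (X n \<omega>)\<^sup>2) / ?K)"
        by (rule integral_mono) (use intY intX intm Y2 X2 pw in auto)
      also have "\<dots> = expectation (?m n) + (2 * expectation (\<lambda>\<omega>. (Y \<omega>)\<^sup>2) + 2 * expectation (\<lambda>\<omega>. (X n \<omega>)\<^sup>2)) / ?K"
        using intm Y2 X2 by (simp del: of_nat_Suc)
      also have "\<dots> \<le> expectation (?m n) + 4 * C / ?K"
        using EY2 C[of n] by (intro add_left_mono divide_right_mono) auto
      finally show ?thesis .
    qed
    then show "\<exists>N. \<forall>n\<ge>N. \<bar>expectation Y\<bar> \<le> expectation (?m n) + 4 * C / ?K" by blast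
  qed
  have "(\<lambda>k. 4 * C * (1 / real (Suc k))) \<longlonglongrightarrow> 4 * C * 0"
    by (intro tendsto_mult tendsto_const LIMSEQ_Suc[OF lim_1_over_n])
  then have z: "(\<lambda>k. 4 * C * (1 / real (Suc k))) \<longlonglongrightarrow> 0" by simp
  have "\<bar>expectation Y\<bar> \<le> 0"
    by (rule LIMSEQ_le_const[OF z]) (use trunc in auto)
  then show "expectation Y = 0" by simp
qed

section \<open>Expected duration of phases with bounded drawdown\<close>

context standard_brownian_motion begin

text \<open>The sign \<open>e\<close> is \<open>1\<close> or \<open>-1\<close>, so drawdowns of
  \<open>B\<close> and of \<open>-B\<close> share all estimates. The moments against
  \<open>H\<close> factor because the increment is independent of the past.\<close>

lemma centered_steps_grid:
  fixes e :: real and N :: nat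
  assumes e: "e\<^sup>2 = 1" and N: "0 < N"
    and act: "\<And>k. Measurable.pred (\<F> (ennreal (k / N))) (act k)"
  shows "centered_steps M (\<lambda>k. \<F> (ennreal (k / N)))
    (\<lambda>k \<omega>. e * (B (Suc k / N) \<omega> - B (k / N) \<omega>)) (1 / N) act"
proof
  have pos: "0 \<le> k / N" "k / N < Suc k / N" "Suc k / N - k / N = 1 / N" for k
    using N by (auto simp: divide_strict_right_mono diff_divide_distrib[symmetric])
  have e4: "e ^ 4 = 1" using arg_cong[OF e, of "\<lambda>x. x\<^sup>2"] by simp
  show "0 < 1 / real N" using N by simp
  fix k
  show "sets (\<F> (ennreal (k / N))) \<subseteq> sets (\<F> (ennreal (Suc k / N)))"
    using pos(2)[of k] by (intro sets_natural_filtration_mono ennreal_leI) simp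
  show "(\<lambda>\<omega>. e * (B (Suc k / N) \<omega> - B (k / N) \<omega>)) \<in> borel_measurable (\<F> (ennreal (Suc k / N)))"
    using pos[of k] by (intro borel_measurable_times borel_measurable_const borel_measurable_diff
        process_measurable_natural_filtration ennreal_leI) auto
  note m = increment_moments[OF pos(1) pos(2), of k]
  show "integrable M (\<lambda>\<omega>. (e * (B (Suc k / N) \<omega> - B (k / N) \<omega>)) ^ 4)"
    unfolding power_mult_distrib using m(1)[of 4] by (intro integrable_mult_right)
  show "expectation (\<lambda>\<omega>. (e * (B (Suc k / N) \<omega> - B (k / N) \<omega>)) ^ 4) = 3 * (1 / N)\<^sup>2"
    unfolding power_mult_distrib e4 using m(4) pos(3)[of k] by simp
  fix H :: "'a \<Rightarrow> real" assume H: "H \<in> borel_measurable (\<F> (ennreal (k / N)))" "integrable M H"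
  note indep = indep_var_past_increment[OF pos(1) pos(2) H(1)]
  have indep2: "indep_var borel H borel (\<lambda>\<omega>. (B (Suc k / N) \<omega> - B (k / N) \<omega>)\<^sup>2)"
    using indep_var_compose[OF indep, of id borel "\<lambda>x. x\<^sup>2" borel] by (simp add: comp_def)
  have m1: "integrable M (\<lambda>\<omega>. B (Suc k / N) \<omega> - B (k / N) \<omega>)" using m(1)[of 1] by simp
  show "integrable M (\<lambda>\<omega>. H \<omega> * (e * (B (Suc k / N) \<omega> - B (k / N) \<omega>)))"
    using indep_var_integrable[OF indep H(2) m1] by (simp add: mult.left_commute[of _ e])
  show "expectation (\<lambda>\<omega>. H \<omega> * (e * (B (Suc k / N) \<omega> - B (k / N) \<omega>))) = 0"
    using indep_var_lebesgue_integral[OF indep H(2) m1] m(2) by (simp add: mult.left_commute[of _ e])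
  show "integrable M (\<lambda>\<omega>. H \<omega> * (e * (B (Suc k / N) \<omega> - B (k / N) \<omega>))\<^sup>2)"
    using indep_var_integrable[OF indep2 H(2) m(1)] unfolding power_mult_distrib e by simp
  show "expectation (\<lambda>\<omega>. H \<omega> * (e * (B (Suc k / N) \<omega> - B (k / N) \<omega>))\<^sup>2) = 1 / N * expectation H"
    using indep_var_lebesgue_integral[OF indep2 H(2) m(1)] m(3) pos(3)[of k]
    unfolding power_mult_distrib e by simp
qed (use act sets_filtration_subset in auto)

lemma integrable_enn2real_stopping_time:
  assumes "stopping_time \<F> \<tau>" "(\<integral>\<^sup>+\<omega>. \<tau> \<omega> \<partial>M) < \<infinity>"
  shows "integrable M (\<lambda>\<omega>. enn2real (\<tau> \<omega>))" "AE \<omega> in M. \<tau> \<omega> < \<infinity>"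
    "(\<integral>\<^sup>+\<omega>. \<tau> \<omega> \<partial>M) = ennreal (expectation (\<lambda>\<omega>. enn2real (\<tau> \<omega>)))"
proof -
  have [measurable]: "\<tau> \<in> borel_measurable M" by (rule stopping_time_measurable[OF assms(1)])
  show ae: "AE \<omega> in M. \<tau> \<omega> < \<infinity>"
    using nn_integral_PInf_AE[of \<tau> M] assms(2) by (auto simp: top.not_eq_extremum)
  have eq: "(\<integral>\<^sup>+\<omega>. \<tau> \<omega> \<partial>M) = (\<integral>\<^sup>+\<omega>. ennreal (enn2real (\<tau> \<omega>)) \<partial>M)"
    by (rule nn_integral_cong_AE) (use ae in auto)
  show int: "integrable M (\<lambda>\<omega>. enn2real (\<tau> \<omega>))"
    by (rule integrableI_nonneg) (use assms(2) eq in auto)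
  show "(\<integral>\<^sup>+\<omega>. \<tau> \<omega> \<partial>M) = ennreal (expectation (\<lambda>\<omega>. enn2real (\<tau> \<omega>)))"
    unfolding eq by (rule nn_integral_eq_integral[OF int]) simp
qed

text \<open>Between \<open>\<sigma>\<close> and \<open>\<rho>\<close> the drawdown of
  \<open>e * B\<close> is at most \<open>d\<close>, so the walk on the grid is at most
  \<open>d\<close> while active, and \<open>active_time_le\<close> bounds the time spent
  there.\<close>

lemma expected_oscillation_duration_le_bounded:
  fixes e d :: real and K :: nat
  assumes e: "e\<^sup>2 = 1" and d: "0 \<le> d"
    and st: "stopping_time \<F> \<sigma>" "stopping_time \<F> \<rho>"
    and osc: "\<And>\<omega> s t. \<omega> \<in> space M \<Longrightarrow> 0 \<le> s \<Longrightarrow> s \<le> t \<Longrightarrow> \<sigma> \<omega> \<le> ennreal s \<Longrightarrow> ennreal t < \<rho> \<omega> \<Longrightarrow>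
      e * (B s \<omega> - B t \<omega>) \<le> d"
  shows "expectation (\<lambda>\<omega>. enn2real (min (\<rho> \<omega>) (ennreal K)))
    \<le> expectation (\<lambda>\<omega>. enn2real (min (\<sigma> \<omega>) (ennreal K))) + d\<^sup>2"
proof -
  have [measurable]: "\<sigma> \<in> borel_measurable M" "\<rho> \<in> borel_measurable M"
    using st by (auto intro: stopping_time_measurable)
  have int: "integrable M (\<lambda>\<omega>. enn2real (min (\<tau> \<omega>) (ennreal K)))"
    if [measurable]: "\<tau> \<in> borel_measurable M" for \<tau> :: "'a \<Rightarrow> ennreal"
  proof (rule integrable_const_bound[where B = K])
    have "enn2real (min (\<tau> \<omega>) (ennreal K)) \<le> enn2real (ennreal K)" for \<omega>
      by (intro enn2real_mono) auto
    then show "AE \<omega> in M. norm (enn2real (min (\<tau> \<omega>) (ennreal K))) \<le> K" by simp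
  qed measurable
  define R S where "R = expectation (\<lambda>\<omega>. enn2real (min (\<rho> \<omega>) (ennreal K)))"
    and "S = expectation (\<lambda>\<omega>. enn2real (min (\<sigma> \<omega>) (ennreal K)))"
  have main: "R \<le> S + 1 / Suc n + (d\<^sup>2 + 3 * d * \<epsilon> + 2 * \<epsilon>\<^sup>2
      + ((2 * d + \<epsilon>) / \<epsilon> ^ 3 + 2 / \<epsilon>\<^sup>2) * (3 * K * (1 / Suc n)))" if \<epsilon>: "0 < \<epsilon>" for n \<epsilon>
  proof -
    let ?N = "Suc n"
    define act where "act k \<omega> \<longleftrightarrow> \<sigma> \<omega> \<le> ennreal (k / ?N) \<and> ennreal (k / ?N) < \<rho> \<omega>" for k :: nat and \<omega>
    define \<xi> where "\<xi> k \<omega> = e * (B (Suc k / ?N) \<omega> - B (k / ?N) \<omega>)" for k :: nat and \<omega>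
    have "Measurable.pred (\<F> (ennreal (k / ?N))) (act k)" for k
      unfolding act_def
      by (intro pred_intros_logic stopping_timeD[OF st(1)] stopping_timeD2[OF st(2)])
    then interpret centered_steps M "\<lambda>k. \<F> (ennreal (k / ?N))" \<xi> "1 / ?N" act
      unfolding \<xi>_def by (intro centered_steps_grid[OF e]) auto
    \<comment> \<open>While active, the walk is the drop since some earlier active grid point
      \<open>i\<close>; reflection at \<open>0\<close> resets \<open>i\<close> to the current point.
      This makes the oscillation hypothesis applicable.\<close>
    have shape: "\<exists>i\<le>k. act i \<omega> \<and> reflected_walk k \<omega> = e * (B (i / ?N) \<omega> - B (k / ?N) \<omega>)"
      if "act k \<omega>" for k \<omega>
      using that
    proof (induction k)
      case 0
      then show ?case by simp
    next
      case (Suc k)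
      have le: "ennreal (k / ?N) \<le> ennreal (Suc k / ?N)"
        by (intro ennreal_leI divide_right_mono) auto
      show ?case
      proof (cases "act k \<omega>")
        case True
        then obtain i where i: "i \<le> k" "act i \<omega>" "reflected_walk k \<omega> = e * (B (i / ?N) \<omega> - B (k / ?N) \<omega>)"
          using Suc by blast
        have *: "reflected_walk (Suc k) \<omega> = max (e * (B (i / ?N) \<omega> - B (Suc k / ?N) \<omega>)) 0"
          using True i(3) by (simp add: \<xi>_def algebra_simps del: of_nat_Suc)
        show ?thesis
        proof (cases "e * (B (i / ?N) \<omega> - B (Suc k / ?N) \<omega>) \<ge> 0")
          case True
          then show ?thesis
            using * i by (intro exI[of _ i]) (simp del: of_nat_Suc reflected_walk.simps)
        next
          case False
          then show ?thesis
            using * Suc.prems by (intro exI[of _ "Suc k"]) (simp del: of_nat_Suc reflected_walk.simps)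
        qed
      next
        case False
        \<comment> \<open>Active indices are consecutive, so if activity begins only at
          \<open>Suc k\<close>, no earlier step was taken and the walk is still at
          \<open>0\<close>.\<close>
        then have early: "ennreal (k / ?N) < \<sigma> \<omega>" using Suc.prems le unfolding act_def by (metis not_le order_le_less_trans)
        have "\<not> act j \<omega>" if "j \<le> k" for j
        proof -
          have "ennreal (j / ?N) \<le> ennreal (k / ?N)"
            using that by (intro ennreal_leI divide_right_mono) auto
          then show ?thesis using early unfolding act_def by (metis leD order_trans)
        qed
        then have "reflected_walk j \<omega> = 0" if "j \<le> Suc k" for j
          using that by (induction j) auto
        then show ?thesis using Suc.prems by (intro exI[of _ "Suc k"]) (simp del: reflected_walk.simps)
      qed
    qed
    have bound: "reflected_walk k \<omega> \<le> d" if \<omega>: "\<omega> \<in> space M" and k: "act k \<omega>" for k \<omega>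
    proof -
      obtain i where i: "i \<le> k" "act i \<omega>" "reflected_walk k \<omega> = e * (B (i / ?N) \<omega> - B (k / ?N) \<omega>)"
        using shape[OF k] by blast
      then show ?thesis
        using osc[OF \<omega>, of "i / ?N" "k / ?N"] k
        by (auto simp: act_def divide_right_mono simp del: of_nat_Suc)
    qed
    have "R \<le> expectation (\<lambda>\<omega>. enn2real (min (\<sigma> \<omega>) (ennreal K)) + 1 / ?N + (\<Sum>k<K * ?N. (1 / ?N) * ind k \<omega>))"
      unfolding R_def
    proof (rule integral_mono[OF int])
      fix \<omega>
      show "enn2real (min (\<rho> \<omega>) (ennreal K))
          \<le> enn2real (min (\<sigma> \<omega>) (ennreal K)) + 1 / ?N + (\<Sum>k<K * ?N. (1 / ?N) * ind k \<omega>)"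
        unfolding ind_def act_def by (rule grid_occupation_lower) simp
    qed (use int integrable_chi in auto)
    also have "\<dots> = S + 1 / ?N + active_time (K * ?N)"
      unfolding S_def active_time_def using int integrable_chi by (simp add: prob_space del: of_nat_Suc)
    also have "active_time (K * ?N) \<le> d\<^sup>2 + 3 * d * \<epsilon> + 2 * \<epsilon>\<^sup>2
      + ((2 * d + \<epsilon>) / \<epsilon> ^ 3 + 2 / \<epsilon>\<^sup>2) * (3 * real (K * ?N) * (1 / ?N)\<^sup>2)"
      by (rule active_time_le[OF \<epsilon> d bound])
    also have "3 * real (K * ?N) * (1 / ?N)\<^sup>2 = 3 * K * (1 / ?N)"
      unfolding of_nat_mult by (simp add: power2_eq_square del: of_nat_Suc)
    finally show ?thesis by simp
  qed
  \<comment> \<open>The mesh is refined first, with \<open>\<epsilon>\<close> fixed, because the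
    coefficient of the mesh error blows up as \<open>\<epsilon>\<close> tends to
    \<open>0\<close>.\<close>
  have lim1: "R \<le> S + (d\<^sup>2 + 3 * d * \<epsilon> + 2 * \<epsilon>\<^sup>2)" if "0 < \<epsilon>" for \<epsilon>
  proof (rule tendsto_lowerbound)
    have z: "(\<lambda>n. 1 / real (Suc n)) \<longlonglongrightarrow> 0" by (rule LIMSEQ_Suc[OF lim_1_over_n])
    show "(\<lambda>n. S + 1 / Suc n + (d\<^sup>2 + 3 * d * \<epsilon> + 2 * \<epsilon>\<^sup>2
      + ((2 * d + \<epsilon>) / \<epsilon> ^ 3 + 2 / \<epsilon>\<^sup>2) * (3 * K * (1 / Suc n)))) \<longlonglongrightarrow> S + (d\<^sup>2 + 3 * d * \<epsilon> + 2 * \<epsilon>\<^sup>2)"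
      by (rule tendsto_eq_intros z refl | simp)+
  qed (use main[OF that] in auto)
  have "R \<le> S + d\<^sup>2"
  proof (rule tendsto_lowerbound)
    show "((\<lambda>\<epsilon>. S + (d\<^sup>2 + 3 * d * \<epsilon> + 2 * \<epsilon>\<^sup>2)) \<longlongrightarrow> S + d\<^sup>2) (at_right 0)"
      by (rule tendsto_eq_intros refl | simp)+
    show "\<forall>\<^sub>F \<epsilon> in at_right 0. R \<le> S + (d\<^sup>2 + 3 * d * \<epsilon> + 2 * \<epsilon>\<^sup>2)"
      using lim1 by (auto simp: eventually_at_right_field intro: exI[of _ 1])
  qed simp
  then show ?thesis by (simp add: R_def S_def)
qed

text \<open>The bound \<open>d\<^sup>2\<close> is uniform in the cut-off \<open>K\<close>, so
  monotone convergence removes it. Stated in \<open>ennreal\<close>, the result also proves that the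
  expectation of \<open>\<rho>\<close> is finite once that of \<open>\<sigma>\<close> is.\<close>

lemma expected_oscillation_duration_le:
  fixes e d :: real
  assumes "e\<^sup>2 = 1" "0 \<le> d"
    and st: "stopping_time \<F> \<sigma>" "stopping_time \<F> \<rho>"
    and osc: "\<And>\<omega> s t. \<omega> \<in> space M \<Longrightarrow> 0 \<le> s \<Longrightarrow> s \<le> t \<Longrightarrow> \<sigma> \<omega> \<le> ennreal s \<Longrightarrow> ennreal t < \<rho> \<omega> \<Longrightarrow>
      e * (B s \<omega> - B t \<omega>) \<le> d"
  shows "(\<integral>\<^sup>+\<omega>. \<rho> \<omega> \<partial>M) \<le> (\<integral>\<^sup>+\<omega>. \<sigma> \<omega> \<partial>M) + ennreal (d\<^sup>2)"
proof -
  have [measurable]: "\<sigma> \<in> borel_measurable M" "\<rho> \<in> borel_measurable M"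
    using st by (auto intro: stopping_time_measurable)
  have eq: "(\<integral>\<^sup>+\<omega>. min (\<tau> \<omega>) (ennreal K) \<partial>M) = ennreal (expectation (\<lambda>\<omega>. enn2real (min (\<tau> \<omega>) (ennreal K))))"
    if st: "stopping_time \<F> \<tau>" for \<tau> and K :: nat
  proof (rule integrable_enn2real_stopping_time(3))
    show "stopping_time \<F> (\<lambda>\<omega>. min (\<tau> \<omega>) (ennreal K))"
      by (intro stopping_time_min st stopping_time_const)
    have "(\<integral>\<^sup>+\<omega>. min (\<tau> \<omega>) (ennreal K) \<partial>M) \<le> (\<integral>\<^sup>+\<omega>. ennreal K \<partial>M)"
      by (intro nn_integral_mono) auto
    then show "(\<integral>\<^sup>+\<omega>. min (\<tau> \<omega>) (ennreal K) \<partial>M) < \<infinity>"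
      by (simp add: emeasure_space_1 order_le_less_trans)
  qed
  have sup_min: "\<rho> \<omega> = (SUP K::nat. min (\<rho> \<omega>) (ennreal K))" for \<omega>
    unfolding ennreal_of_nat_eq_real_of_nat[symmetric] inf_min[symmetric]
      inf_SUP[symmetric] ennreal_SUP_of_nat_eq_top by simp
  have "(\<integral>\<^sup>+\<omega>. \<rho> \<omega> \<partial>M) = (\<integral>\<^sup>+\<omega>. (SUP K::nat. min (\<rho> \<omega>) (ennreal K)) \<partial>M)"
    using sup_min by simp
  also have "\<dots> = (SUP K::nat. \<integral>\<^sup>+\<omega>. min (\<rho> \<omega>) (ennreal K) \<partial>M)"
    by (rule nn_integral_monotone_convergence_SUP)
      (auto simp: incseq_def le_fun_def min_le_iff_disj intro!: min.mono ennreal_leI)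
  also have "\<dots> \<le> (\<integral>\<^sup>+\<omega>. \<sigma> \<omega> \<partial>M) + ennreal (d\<^sup>2)"
  proof (rule SUP_least)
    fix K :: nat
    have "(\<integral>\<^sup>+\<omega>. min (\<rho> \<omega>) (ennreal K) \<partial>M)
        \<le> ennreal (expectation (\<lambda>\<omega>. enn2real (min (\<sigma> \<omega>) (ennreal K))) + d\<^sup>2)"
      unfolding eq[OF st(2)] by (rule ennreal_leI[OF expected_oscillation_duration_le_bounded]) fact+
    also have "\<dots> = (\<integral>\<^sup>+\<omega>. min (\<sigma> \<omega>) (ennreal K) \<partial>M) + ennreal (d\<^sup>2)"
      unfolding eq[OF st(1)] by (rule ennreal_plus) auto
    also have "\<dots> \<le> (\<integral>\<^sup>+\<omega>. \<sigma> \<omega> \<partial>M) + ennreal (d\<^sup>2)"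
      by (intro add_right_mono nn_integral_mono) auto
    finally show "(\<integral>\<^sup>+\<omega>. min (\<rho> \<omega>) (ennreal K) \<partial>M) \<le> (\<integral>\<^sup>+\<omega>. \<sigma> \<omega> \<partial>M) + ennreal (d\<^sup>2)" .
  qed
  finally show ?thesis .
qed

section \<open>Wald's identity at stopping times of finite expectation\<close>

lemma active_time_grid_le:
  fixes N n :: nat
  assumes st: "stopping_time \<F> \<tau>" "(\<integral>\<^sup>+\<omega>. \<tau> \<omega> \<partial>M) < \<infinity>" and N: "0 < N"
  shows "(\<Sum>k<n. 1 / real N * expectation (\<lambda>\<omega>. if ennreal (k / N) < \<tau> \<omega> then 1 else 0))
    \<le> expectation (\<lambda>\<omega>. enn2real (\<tau> \<omega>)) + 1 / N"
proof -
  note fin = integrable_enn2real_stopping_time[OF st]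
  have [measurable]: "\<tau> \<in> borel_measurable M" by (rule stopping_time_measurable[OF st(1)])
  have int: "integrable M (\<lambda>\<omega>. if ennreal (k / N) < \<tau> \<omega> then 1 else 0 :: real)" for k
    by (rule integrable_const_bound[where B = 1]) auto
  have "(\<Sum>k<n. 1 / real N * expectation (\<lambda>\<omega>. if ennreal (k / N) < \<tau> \<omega> then 1 else 0))
      = expectation (\<lambda>\<omega>. \<Sum>k<n. 1 / real N * (if ennreal (k / N) < \<tau> \<omega> then 1 else 0))"
    using int by simp
  also have "\<dots> \<le> expectation (\<lambda>\<omega>. enn2real (\<tau> \<omega>) + 1 / N)"
  proof (rule integral_mono_AE)
    show "AE \<omega> in M. (\<Sum>k<n. 1 / real N * (if ennreal (k / N) < \<tau> \<omega> then 1 else 0)) \<le> enn2real (\<tau> \<omega>) + 1 / N"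
      using fin(2)
    proof eventually_elim
      case (elim \<omega>)
      then show ?case using grid_occupation_upper[OF N, of "enn2real (\<tau> \<omega>)" n] by simp
    qed
  qed (use int fin(1) in auto)
  also have "\<dots> = expectation (\<lambda>\<omega>. enn2real (\<tau> \<omega>)) + 1 / N"
    using fin(1) by (simp add: prob_space)
  finally show ?thesis .
qed

text \<open>Activity ends at the first grid point at or after \<open>\<tau>\<close>, which is why
  times are rounded up to the grid.\<close>

lemma grid_active_iff:
  assumes "0 < N" "\<tau> < \<infinity>"
  shows "ennreal (real k / real N) < \<tau> \<longleftrightarrow> k < nat \<lceil>enn2real \<tau> * N\<rceil>"
proof -
  have "ennreal (real k / real N) < \<tau> \<longleftrightarrow> ennreal (real k / real N) < ennreal (enn2real \<tau>)"
    using assms(2) by simp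
  also have "\<dots> \<longleftrightarrow> real k / real N < enn2real \<tau>"
    by (simp add: ennreal_less_iff)
  also have "\<dots> \<longleftrightarrow> real k < enn2real \<tau> * N"
    using assms(1) by (simp add: pos_divide_less_eq)
  also have "\<dots> \<longleftrightarrow> k < nat \<lceil>enn2real \<tau> * N\<rceil>"
    by linarith
  finally show ?thesis .
qed

lemma measurable_B_at_stopping_time:
  assumes "stopping_time \<F> \<tau>"
  shows "(\<lambda>\<omega>. B (enn2real (\<tau> \<omega>)) \<omega>) \<in> borel_measurable M"
  by (rule borel_measurable_at_random_time[OF measurable_B continuous_paths])
    (use stopping_time_measurable[OF assms] in auto)

lemma B_at_grid_LIMSEQ:
  fixes t :: real
  assumes "\<omega> \<in> space M" "0 \<le> t"
  shows "(\<lambda>n. B (nat \<lceil>t * Suc n\<rceil> / Suc n) \<omega>) \<longlonglongrightarrow> B t \<omega>"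
proof (rule continuous_on_tendsto_compose[OF continuous_paths[OF assms(1)] grid_point_LIMSEQ[OF assms(2)]])
  show "\<forall>\<^sub>F n in sequentially. real (nat \<lceil>t * Suc n\<rceil>) / Suc n \<in> {0..}"
    unfolding atLeast_iff by (intro always_eventually allI divide_nonneg_nonneg of_nat_0_le_iff)
qed (use assms in simp)

text \<open>The sums of active increments have mean \<open>0\<close> and second moments bounded by
  the expectation of \<open>\<tau>\<close> plus one. They converge to \<open>B\<close> at
  \<open>\<tau>\<close>, so \<open>expectation_zero_LIMSEQ\<close> applies.\<close>

lemma expectation_at_stopping_time:
  assumes st: "stopping_time \<F> \<tau>" "(\<integral>\<^sup>+\<omega>. \<tau> \<omega> \<partial>M) < \<infinity>"
  shows "integrable M (\<lambda>\<omega>. B (enn2real (\<tau> \<omega>)) \<omega>)" "expectation (\<lambda>\<omega>. B (enn2real (\<tau> \<omega>)) \<omega>) = 0"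
proof -
  define \<xi> where "\<xi> n k \<omega> = 1 * (B (Suc k / Suc n) \<omega> - B (k / Suc n) \<omega>)" for n k :: nat and \<omega>
  define act where "act n k \<omega> \<longleftrightarrow> ennreal (k / Suc n) < \<tau> \<omega>" for n k :: nat and \<omega>
  \<comment> \<open>\<open>Suc n * Suc n\<close> steps of length \<open>1 / Suc n\<close> reach time
    \<open>Suc n\<close>: the mesh shrinks and the horizon grows together.\<close>
  define X where "X n \<omega> = (\<Sum>k<Suc n * Suc n. (if act n k \<omega> then 1 else 0) * \<xi> n k \<omega>)" for n \<omega>
  have steps: "centered_steps M (\<lambda>k. \<F> (ennreal (k / Suc n))) (\<xi> n) (1 / Suc n) (act n)" for n
    unfolding \<xi>_def act_def by (intro centered_steps_grid stopping_timeD2[OF st(1)]) auto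
  have X: "integrable M (X n)" "expectation (X n) = 0" "integrable M (\<lambda>\<omega>. (X n \<omega>)\<^sup>2)"
    "expectation (\<lambda>\<omega>. (X n \<omega>)\<^sup>2) \<le> expectation (\<lambda>\<omega>. enn2real (\<tau> \<omega>)) + 1" for n
  proof -
    interpret centered_steps M "\<lambda>k. \<F> (ennreal (k / Suc n))" "\<xi> n" "1 / Suc n" "act n"
      by (rule steps)
    have X: "X n = stopped_sum (Suc n * Suc n)"
      unfolding X_def[abs_def] stopped_sum_def[abs_def] ind_def ..
    show "integrable M (X n)" "expectation (X n) = 0" "integrable M (\<lambda>\<omega>. (X n \<omega>)\<^sup>2)"
      unfolding X by (rule stopped_sum_moments)+
    have "expectation (\<lambda>\<omega>. (X n \<omega>)\<^sup>2) = active_time (Suc n * Suc n)"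
      unfolding X by (rule stopped_sum_moments)
    also have "\<dots> \<le> expectation (\<lambda>\<omega>. enn2real (\<tau> \<omega>)) + 1 / Suc n"
      unfolding active_time_def ind_def[abs_def] act_def by (rule active_time_grid_le[OF st]) simp
    also have "1 / real (Suc n) \<le> 1" by simp
    finally show "expectation (\<lambda>\<omega>. (X n \<omega>)\<^sup>2) \<le> expectation (\<lambda>\<omega>. enn2real (\<tau> \<omega>)) + 1" by simp
  qed
  have lim: "AE \<omega> in M. (\<lambda>n. X n \<omega>) \<longlonglongrightarrow> B (enn2real (\<tau> \<omega>)) \<omega>"
    using integrable_enn2real_stopping_time(2)[OF st] AE_space
  proof eventually_elim
    case (elim \<omega>)
    define T where "T = enn2real (\<tau> \<omega>)"
    \<comment> \<open>The active steps form an initial segment, so the sum telescopes from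
      \<open>B 0 \<omega> = 0\<close>.\<close>
    have sum: "(\<Sum>k<m. (if act n k \<omega> then 1 else 0) * \<xi> n k \<omega>) = B (min m (nat \<lceil>T * Suc n\<rceil>) / Suc n) \<omega>" for n m
    proof (induction m)
      case 0
      then show ?case using B_0 elim by simp
    next
      case (Suc m)
      have "act n m \<omega> \<longleftrightarrow> m < nat \<lceil>T * Suc n\<rceil>"
        unfolding act_def T_def using elim(1) by (intro grid_active_iff) auto
      then show ?case
        unfolding sum.lessThan_Suc Suc by (auto simp: \<xi>_def min_def simp del: of_nat_Suc)
    qed
    show ?case
      unfolding T_def[symmetric]
    proof (rule Lim_transform_eventually[OF B_at_grid_LIMSEQ])
      show "\<forall>\<^sub>F n in sequentially. B (nat \<lceil>T * Suc n\<rceil> / Suc n) \<omega> = X n \<omega>"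
        using eventually_ge_at_top[of "nat \<lceil>T\<rceil>"]
      proof eventually_elim
        case (elim n)
        then have "T \<le> Suc n" by linarith
        then have "T * Suc n \<le> real (Suc n * Suc n)"
          unfolding of_nat_mult by (intro mult_right_mono) auto
        then have "nat \<lceil>T * Suc n\<rceil> \<le> Suc n * Suc n" by (simp only: nat_le_iff ceiling_le_iff of_int_of_nat_eq)
        then show ?case unfolding X_def sum by (simp only: min_absorb2)
      qed
    qed (use elim in \<open>auto simp: T_def\<close>)
  qed
  show "integrable M (\<lambda>\<omega>. B (enn2real (\<tau> \<omega>)) \<omega>)" "expectation (\<lambda>\<omega>. B (enn2real (\<tau> \<omega>)) \<omega>) = 0"
    using expectation_zero_LIMSEQ[OF _ X(3) X(2) X(4) lim measurable_B_at_stopping_time[OF st(1)]]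
      borel_measurable_integrable[OF X(1)] by auto
qed

section \<open>Upper bound for the expected maximal drawdown at a stopping time\<close>

lemma max_drawdown_attained:
  assumes "\<omega> \<in> space M" "0 \<le> t"
  obtains u v where "0 \<le> u" "u \<le> v" "v \<le> t" "max_drawdown B t \<omega> = B u \<omega> - B v \<omega>"
proof -
  obtain v where v: "0 \<le> v" "v \<le> t" "max_drawdown B t \<omega> = drop_process B v \<omega>"
    using running_max_attained[of "drop_process B" \<omega> t] continuous_drop_process assms
    unfolding max_drawdown_def by metis
  obtain u where "0 \<le> u" "u \<le> v" "running_max B v \<omega> = B u \<omega>"
    using running_max_attained[of B \<omega> v] continuous_paths assms v by metis
  with v show ?thesis by (intro that[of u v]) (auto simp: drop_process_def)
qed

lemma measurable_max_drawdown_at_stopping_time: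
  assumes "stopping_time \<F> \<tau>"
  shows "(\<lambda>\<omega>. max_drawdown B (enn2real (\<tau> \<omega>)) \<omega>) \<in> borel_measurable M"
proof (rule borel_measurable_at_random_time[OF _ continuous_max_drawdown])
  show "max_drawdown B t \<in> borel_measurable M" if "0 \<le> t" for t
    using adapted_max_drawdown that filtration_measurable unfolding adapted_def by blast
qed (use stopping_time_measurable[OF assms] in auto)

lemma max_drawdown_nonneg:
  assumes "\<omega> \<in> space M" "0 \<le> t"
  shows "0 \<le> max_drawdown B t \<omega>"
  using running_max_upper[of "drop_process B" \<omega> 0 t] continuous_drop_process[OF assms(1)] assms
  by (simp add: max_drawdown_def drop_process_def running_max_0)

text \<open>The peaks of the grid walks dominate the drawdown at \<open>\<tau>\<close> in the limit
  inferior; \<open>expectation_peak_le\<close> bounds their means, and Fatou's lemma gives both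
  integrability and the estimate.\<close>

lemma expectation_max_drawdown_le:
  assumes st: "stopping_time \<F> \<tau>" "(\<integral>\<^sup>+\<omega>. \<tau> \<omega> \<partial>M) < \<infinity>" and c: "0 < c"
  shows "integrable M (\<lambda>\<omega>. max_drawdown B (enn2real (\<tau> \<omega>)) \<omega>)"
    and "expectation (\<lambda>\<omega>. max_drawdown B (enn2real (\<tau> \<omega>)) \<omega>)
      \<le> 1 / (2 * c) + c * expectation (\<lambda>\<omega>. enn2real (\<tau> \<omega>))"
proof -
  let ?E = "expectation (\<lambda>\<omega>. enn2real (\<tau> \<omega>))"
  define \<xi> where "\<xi> n k \<omega> = 1 * (B (Suc k / Suc n) \<omega> - B (k / Suc n) \<omega>)" for n k :: nat and \<omega>
  define act where "act n k \<omega> \<longleftrightarrow> ennreal (k / Suc n) < \<tau> \<omega>" for n k :: nat and \<omega>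
  define P where "P n = centered_steps.peak (\<xi> n) (act n) (Suc n * Suc n)" for n
  have steps: "centered_steps M (\<lambda>k. \<F> (ennreal (k / Suc n))) (\<xi> n) (1 / Suc n) (act n)" for n
    unfolding \<xi>_def act_def by (intro centered_steps_grid stopping_timeD2[OF st(1)]) auto
  have E_nonneg: "0 \<le> ?E" by (simp add: integral_nonneg_AE)
  have P: "P n \<in> borel_measurable M" "(\<integral>\<^sup>+\<omega>. ennreal (P n \<omega>) \<partial>M) \<le> ennreal (1 / (2 * c) + c * (?E + 1 / Suc n))" for n
  proof -
    interpret centered_steps M "\<lambda>k. \<F> (ennreal (k / Suc n))" "\<xi> n" "1 / Suc n" "act n"
      by (rule steps)
    have int: "integrable M (P n)" unfolding P_def by (rule integrable_peak)
    then show "P n \<in> borel_measurable M" by auto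
    have nonneg: "AE \<omega> in M. 0 \<le> P n \<omega>"
      unfolding P_def by (rule AE_I2, rule peak_nonneg)
    have "expectation (P n) \<le> 1 / (2 * c) + c * active_time (Suc n * Suc n)"
      unfolding P_def by (rule expectation_peak_le[OF c])
    also have "\<dots> \<le> 1 / (2 * c) + c * (?E + 1 / Suc n)"
      unfolding active_time_def ind_def[abs_def] act_def
      by (intro add_left_mono mult_left_mono active_time_grid_le[OF st]) (use c in auto)
    finally have "ennreal (expectation (P n)) \<le> ennreal (1 / (2 * c) + c * (?E + 1 / Suc n))"
      by (rule ennreal_leI)
    then show "(\<integral>\<^sup>+\<omega>. ennreal (P n \<omega>) \<partial>M) \<le> ennreal (1 / (2 * c) + c * (?E + 1 / Suc n))"
      using nn_integral_eq_integral[OF int nonneg] by simp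
  qed
  \<comment> \<open>The reflected walk never moves below the free step, so by induction it dominates
    the drop from every earlier grid point.\<close>
  have P_ge: "B (i / Suc n) \<omega> - B (j / Suc n) \<omega> \<le> P n \<omega>"
    if ij: "i \<le> j" "j \<le> Suc n * Suc n" and active: "\<And>k. k < j \<Longrightarrow> act n k \<omega>" for n i j :: nat and \<omega>
  proof -
    interpret centered_steps M "\<lambda>k. \<F> (ennreal (k / Suc n))" "\<xi> n" "1 / Suc n" "act n"
      by (rule steps)
    have "B (i / Suc n) \<omega> - B (j / Suc n) \<omega> \<le> reflected_walk j \<omega>"
      using ij(1) active
    proof (induction j rule: dec_induct)
      case base
      then show ?case by (simp add: reflected_walk_nonneg)
    next
      case (step k)
      then have "act n k \<omega>" by simp
      then have "reflected_walk (Suc k) \<omega> \<ge> reflected_walk k \<omega> - \<xi> n k \<omega>" by simp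
      moreover have "B (i / Suc n) \<omega> - B (k / Suc n) \<omega> \<le> reflected_walk k \<omega>"
        using step by simp
      moreover have "\<xi> n k \<omega> = B (Suc k / Suc n) \<omega> - B (k / Suc n) \<omega>"
        unfolding \<xi>_def by simp
      ultimately show ?case by linarith
    qed
    also have "\<dots> \<le> P n \<omega>" unfolding P_def by (rule reflected_walk_le_peak[OF ij(2)])
    finally show ?thesis .
  qed
  have lower: "AE \<omega> in M. ennreal (max_drawdown B (enn2real (\<tau> \<omega>)) \<omega>) \<le> liminf (\<lambda>n. ennreal (P n \<omega>))"
    using integrable_enn2real_stopping_time(2)[OF st] AE_space
  proof eventually_elim
    case (elim \<omega>)
    define T where "T = enn2real (\<tau> \<omega>)"
    \<comment> \<open>The two times realising the drawdown are rounded up to the grid. Rounding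
      preserves their order, and \<open>v \<le> T\<close> keeps all steps before the rounded
      \<open>v\<close> active.\<close>
    obtain u v where uv: "0 \<le> u" "u \<le> v" "v \<le> T" "max_drawdown B T \<omega> = B u \<omega> - B v \<omega>"
      using max_drawdown_attained[OF elim(2), of T] by (auto simp: T_def simp del: of_nat_Suc)
    let ?g = "\<lambda>(t::real) n::nat. nat \<lceil>t * Suc n\<rceil>"
    have "(\<lambda>n. ennreal (B (?g u n / Suc n) \<omega> - B (?g v n / Suc n) \<omega>)) \<longlonglongrightarrow> ennreal (B u \<omega> - B v \<omega>)"
      using elim uv by (intro tendsto_ennrealI tendsto_diff B_at_grid_LIMSEQ) auto
    then have "ennreal (B u \<omega> - B v \<omega>) = liminf (\<lambda>n. ennreal (B (?g u n / Suc n) \<omega> - B (?g v n / Suc n) \<omega>))"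
      by (intro lim_imp_Liminf[symmetric]) auto
    also have "\<dots> \<le> liminf (\<lambda>n. ennreal (P n \<omega>))"
    proof (rule Liminf_mono)
      show "\<forall>\<^sub>F n in sequentially. ennreal (B (?g u n / Suc n) \<omega> - B (?g v n / Suc n) \<omega>) \<le> ennreal (P n \<omega>)"
        using eventually_ge_at_top[of "nat \<lceil>v\<rceil>"]
      proof eventually_elim
        case (elim n)
        then have "v \<le> Suc n" by linarith
        then have "v * Suc n \<le> real (Suc n * Suc n)"
          unfolding of_nat_mult by (intro mult_right_mono) auto
        then have 1: "?g v n \<le> Suc n * Suc n" by (simp only: nat_le_iff ceiling_le_iff of_int_of_nat_eq)
        have 2: "?g s n \<le> ?g t n" if "s \<le> t" for s t
          using that by (intro nat_mono ceiling_mono mult_right_mono) auto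
        have "act n k \<omega>" if "k < ?g v n" for k
        proof -
          have "k < ?g T n" by (rule less_le_trans[OF that 2[OF uv(3)]])
          then show ?thesis
            unfolding act_def using \<open>\<tau> \<omega> < \<infinity>\<close> by (subst grid_active_iff) (auto simp: T_def simp del: of_nat_Suc)
        qed
        then show ?case by (intro ennreal_leI P_ge 1 2 uv)
      qed
    qed
    finally show ?case using uv by (simp add: T_def)
  qed
  have "(\<integral>\<^sup>+\<omega>. ennreal (max_drawdown B (enn2real (\<tau> \<omega>)) \<omega>) \<partial>M) \<le> (\<integral>\<^sup>+\<omega>. liminf (\<lambda>n. ennreal (P n \<omega>)) \<partial>M)"
    by (rule nn_integral_mono_AE[OF lower])
  also have "\<dots> \<le> liminf (\<lambda>n. \<integral>\<^sup>+\<omega>. ennreal (P n \<omega>) \<partial>M)"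
    by (rule nn_integral_liminf) (use P(1) in measurable)
  also have "\<dots> \<le> liminf (\<lambda>n. ennreal (1 / (2 * c) + c * (?E + 1 / Suc n)))"
    by (intro Liminf_mono always_eventually allI P(2))
  also have "\<dots> = ennreal (1 / (2 * c) + c * ?E)"
  proof (rule lim_imp_Liminf)
    have "(\<lambda>n. 1 / real (Suc n)) \<longlonglongrightarrow> 0" by (rule LIMSEQ_Suc[OF lim_1_over_n])
    then have "(\<lambda>n. 1 / (2 * c) + c * (?E + 1 / Suc n)) \<longlonglongrightarrow> 1 / (2 * c) + c * (?E + 0)"
      by (intro tendsto_intros)
    then show "(\<lambda>n. ennreal (1 / (2 * c) + c * (?E + 1 / Suc n))) \<longlonglongrightarrow> ennreal (1 / (2 * c) + c * ?E)"
      by (intro tendsto_ennrealI) simp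
  qed simp
  finally have nn: "(\<integral>\<^sup>+\<omega>. ennreal (max_drawdown B (enn2real (\<tau> \<omega>)) \<omega>) \<partial>M) \<le> ennreal (1 / (2 * c) + c * ?E)" .
  have ae: "AE \<omega> in M. 0 \<le> max_drawdown B (enn2real (\<tau> \<omega>)) \<omega>"
    using max_drawdown_nonneg by (auto intro!: AE_I2)
  show int: "integrable M (\<lambda>\<omega>. max_drawdown B (enn2real (\<tau> \<omega>)) \<omega>)"
    by (rule integrableI_nonneg[OF measurable_max_drawdown_at_stopping_time[OF st(1)] ae])
      (use nn in \<open>auto simp: le_less_trans\<close>)
  have "ennreal (expectation (\<lambda>\<omega>. max_drawdown B (enn2real (\<tau> \<omega>)) \<omega>)) \<le> ennreal (1 / (2 * c) + c * ?E)"
    using nn nn_integral_eq_integral[OF int ae] by simp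
  then show "expectation (\<lambda>\<omega>. max_drawdown B (enn2real (\<tau> \<omega>)) \<omega>) \<le> 1 / (2 * c) + c * ?E"
    using c E_nonneg by (subst (asm) ennreal_le_iff) auto
qed

section \<open>The two phases of the drawdown time\<close>

lemma drop_process_nonneg:
  assumes "\<omega> \<in> space M" "0 \<le> t"
  shows "0 \<le> drop_process B t \<omega>"
  using running_max_upper[of B \<omega> t t] continuous_paths[OF assms(1)] assms(2)
  by (simp add: drop_process_def)

lemma max_drawdown_ge_iff:
  assumes "\<omega> \<in> space M" "0 \<le> t"
  shows "d \<le> max_drawdown B t \<omega> \<longleftrightarrow> hitting_time (drop_process B) d \<omega> \<le> ennreal t"
  using hitting_time_le_iff[of "drop_process B" \<omega> t d] continuous_drop_process[OF assms(1)] assms(2)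
  by (simp add: max_drawdown_def)

text \<open>As \<open>A\<close> is nonnegative, \<open>D - A \<ge> d\<close> forces
  \<open>D \<ge> d\<close>.\<close>

lemma drop_hitting_time_le_drop_drawdown_time:
  assumes "\<omega> \<in> space M"
  shows "hitting_time (drop_process B) d \<omega> \<le> drop_drawdown_time B d \<omega>"
  unfolding drop_drawdown_time_eq_hitting_time hitting_time_def[of "\<lambda>t \<omega>. max_drawdown B t \<omega> - drop_process B t \<omega>"]
proof (rule Inf_greatest)
  fix x assume "x \<in> ennreal ` {t. 0 \<le> t \<and> d \<le> max_drawdown B t \<omega> - drop_process B t \<omega>}"
  then obtain t where t: "x = ennreal t" "0 \<le> t" "d \<le> max_drawdown B t \<omega> - drop_process B t \<omega>" by auto
  then have "d \<le> max_drawdown B t \<omega>" using drop_process_nonneg[OF assms, of t] by simp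
  then show "hitting_time (drop_process B) d \<omega> \<le> x"
    using max_drawdown_ge_iff[OF assms t(2)] t(1) by simp
qed

text \<open>A new maximum of \<open>B\<close> at a time \<open>r\<close> would mean
  \<open>A = 0\<close> there, while \<open>D \<ge> d\<close> already holds after the first phase.
  Then \<open>D - A \<ge> d\<close> at \<open>r\<close>, which ends the second phase.\<close>

lemma running_max_constant_between:
  assumes \<omega>: "\<omega> \<in> space M" and st: "0 \<le> s" "s \<le> t"
    and s: "hitting_time (drop_process B) d \<omega> \<le> ennreal s" and t: "ennreal t < drop_drawdown_time B d \<omega>"
  shows "running_max B t \<omega> = running_max B s \<omega>"
proof (rule ccontr)
  note cont = continuous_paths[OF \<omega>]
  assume "running_max B t \<omega> \<noteq> running_max B s \<omega>"
  then have less: "running_max B s \<omega> < running_max B t \<omega>"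
    using running_max_mono[of B \<omega> s t, OF cont st] by simp
  obtain r where r: "0 \<le> r" "r \<le> t" "running_max B t \<omega> = B r \<omega>"
    using running_max_attained[of B \<omega> t] cont st by (metis order_trans)
  have "s \<le> r"
    using less running_max_upper[of B \<omega> r s, OF cont r(1)] r(3) by linarith
  have "drop_process B r \<omega> \<le> 0"
    using running_max_mono[of B \<omega> r t, OF cont r(1,2)] r(3) by (simp add: drop_process_def)
  moreover have "d \<le> max_drawdown B r \<omega>"
    unfolding max_drawdown_ge_iff[OF \<omega> r(1)] using s \<open>s \<le> r\<close> by (meson ennreal_leI order_trans)
  moreover have "max_drawdown B r \<omega> - drop_process B r \<omega> < d"
    using below_before_hitting_time[OF r(1), of "\<lambda>t \<omega>. max_drawdown B t \<omega> - drop_process B t \<omega>" d \<omega>]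
      t r(2) unfolding drop_drawdown_time_eq_hitting_time by (meson ennreal_leI order_le_less_trans)
  ultimately show False by simp
qed

lemma oscillation_before_drop_hitting_time:
  assumes \<omega>: "\<omega> \<in> space M" and st: "0 \<le> s" "s \<le> t" and t: "ennreal t < hitting_time (drop_process B) d \<omega>"
  shows "B s \<omega> - B t \<omega> \<le> d"
proof -
  have "drop_process B t \<omega> < d"
    using st t by (intro below_before_hitting_time) auto
  then show ?thesis
    using running_max_upper[of B \<omega> s t, OF continuous_paths[OF \<omega>] st] by (simp add: drop_process_def)
qed

text \<open>With the maximum of \<open>B\<close> constant, a rise of \<open>B\<close> is a fall of
  \<open>A\<close>, and a fall of \<open>A\<close> from a past value is at most
  \<open>D - A\<close>, which is below \<open>d\<close> in this phase.\<close>

lemma oscillation_after_drop_hitting_time: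
  assumes \<omega>: "\<omega> \<in> space M" and st: "0 \<le> s" "s \<le> t"
    and s: "hitting_time (drop_process B) d \<omega> \<le> ennreal s" and t: "ennreal t < drop_drawdown_time B d \<omega>"
  shows "B t \<omega> - B s \<omega> \<le> d"
proof -
  have t0: "0 \<le> t" using st by simp
  have "max_drawdown B t \<omega> - drop_process B t \<omega> < d"
    using below_before_hitting_time[OF t0, of "\<lambda>t \<omega>. max_drawdown B t \<omega> - drop_process B t \<omega>" d \<omega>] t
    unfolding drop_drawdown_time_eq_hitting_time .
  moreover have "drop_process B s \<omega> \<le> max_drawdown B t \<omega>"
    unfolding max_drawdown_def
    using running_max_upper[of "drop_process B" \<omega> s t, OF continuous_drop_process[OF \<omega>] st] .
  ultimately show ?thesis
    using running_max_constant_between[OF assms] by (simp add: drop_process_def)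
qed

text \<open>At the end of the first phase the maximum of \<open>B\<close> exceeds \<open>B\<close>
  by \<open>d\<close>; at the end of the second, \<open>D = A + d\<close>. The two combine because
  the maximum is the same at both times.\<close>

lemma max_drawdown_at_drop_drawdown_time:
  assumes \<omega>: "\<omega> \<in> space M" and d: "0 < d" and fin: "drop_drawdown_time B d \<omega> < \<infinity>"
  shows "max_drawdown B (enn2real (drop_drawdown_time B d \<omega>)) \<omega> =
    2 * d + B (enn2real (hitting_time (drop_process B) d \<omega>)) \<omega> - B (enn2real (drop_drawdown_time B d \<omega>)) \<omega>"
proof -
  define T T1 where "T = enn2real (drop_drawdown_time B d \<omega>)"
    and "T1 = enn2real (hitting_time (drop_process B) d \<omega>)"
  note le = drop_hitting_time_le_drop_drawdown_time[OF \<omega>, of d]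
  have T: "0 \<le> T" "drop_drawdown_time B d \<omega> = ennreal T" using fin by (auto simp: T_def)
  have T1: "0 \<le> T1" "hitting_time (drop_process B) d \<omega> = ennreal T1"
    using fin le by (auto simp: T1_def)
  have T1_le: "T1 \<le> T" unfolding T_def T1_def using le fin by (intro enn2real_mono) auto
  have drop0: "drop_process B 0 \<omega> = 0" by (simp add: drop_process_def running_max_0)
  have 1: "drop_process B T1 \<omega> = d"
    using at_hitting_time[of "drop_process B" \<omega> T1 d] continuous_drop_process[OF \<omega>] T1 drop0 d by simp
  have 2: "max_drawdown B T \<omega> - drop_process B T \<omega> = d"
    using at_hitting_time[of "\<lambda>t \<omega>. max_drawdown B t \<omega> - drop_process B t \<omega>" \<omega> T d]
      continuous_on_diff[OF continuous_max_drawdown[OF \<omega>] continuous_drop_process[OF \<omega>]]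
      T drop0 d unfolding drop_drawdown_time_eq_hitting_time
    by (simp add: max_drawdown_def running_max_0)
  have "running_max B T \<omega> = running_max B T1 \<omega>"
  proof (cases "T1 = T")
    case False
    show ?thesis
    \<comment> \<open>Constancy is known only strictly before \<open>T\<close>; continuity extends
      it to \<open>T\<close>.\<close>
    proof (rule continuous_constant_on_closure[where S = "{T1..<T}" and f = "\<lambda>t. running_max B t \<omega>"])
      show "continuous_on (closure {T1..<T}) (\<lambda>t. running_max B t \<omega>)"
        by (rule continuous_on_subset[OF continuous_on_running_max[of B \<omega>, OF continuous_paths[OF \<omega>]]])
          (use False T1 T1_le in auto)
      show "T \<in> closure {T1..<T}" using False T1_le by simp
      fix t assume t: "t \<in> {T1..<T}"
      show "running_max B t \<omega> = running_max B T1 \<omega>"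
        by (rule running_max_constant_between[OF \<omega> T1(1), where d = d])
          (use t T1 T in \<open>auto intro: ennreal_lessI\<close>)
    qed
  qed simp
  then show ?thesis
    using 1 2 unfolding T_def[symmetric] T1_def[symmetric] by (simp add: drop_process_def)
qed

lemma drop_drawdown_time_moments:
  assumes d: "0 < d"
  shows "(\<integral>\<^sup>+\<omega>. drop_drawdown_time B d \<omega> \<partial>M) = ennreal (2 * d\<^sup>2)"
    and "expectation (\<lambda>\<omega>. max_drawdown B (enn2real (drop_drawdown_time B d \<omega>)) \<omega>) = 2 * d"
proof -
  let ?T = "drop_drawdown_time B d" and ?T1 = "hitting_time (drop_process B) d"
  note st = stopping_time_drop_drawdown_time[of d] stopping_time_drop_hitting_time[of d]
  \<comment> \<open>First phase: start at the constant time \<open>0\<close>, with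
    \<open>e = 1\<close> because falls of \<open>B\<close> are bounded.\<close>
  have "(\<integral>\<^sup>+\<omega>. ?T1 \<omega> \<partial>M) \<le> (\<integral>\<^sup>+\<omega>. 0 \<partial>M) + ennreal (d\<^sup>2)"
    by (rule expected_oscillation_duration_le[where e = 1, OF _ _ stopping_time_const st(2)])
      (use d oscillation_before_drop_hitting_time in auto)
  then have T1: "(\<integral>\<^sup>+\<omega>. ?T1 \<omega> \<partial>M) \<le> ennreal (d\<^sup>2)" by simp
  \<comment> \<open>Second phase: \<open>e = -1\<close> because now rises of \<open>B\<close> are
    bounded.\<close>
  have "(\<integral>\<^sup>+\<omega>. ?T \<omega> \<partial>M) \<le> (\<integral>\<^sup>+\<omega>. ?T1 \<omega> \<partial>M) + ennreal (d\<^sup>2)"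
    by (rule expected_oscillation_duration_le[where e = "-1", OF _ _ st(2,1)])
      (use d oscillation_after_drop_hitting_time in auto)
  also have "\<dots> \<le> ennreal (d\<^sup>2) + ennreal (d\<^sup>2)" using T1 by (rule add_right_mono)
  also have "\<dots> = ennreal (2 * d\<^sup>2)" by (simp flip: ennreal_plus)
  finally have T: "(\<integral>\<^sup>+\<omega>. ?T \<omega> \<partial>M) \<le> ennreal (2 * d\<^sup>2)" .
  have fin: "(\<integral>\<^sup>+\<omega>. ?T \<omega> \<partial>M) < \<infinity>" "(\<integral>\<^sup>+\<omega>. ?T1 \<omega> \<partial>M) < \<infinity>"
    using T T1 by (auto intro: le_less_trans)
  note B_T = expectation_at_stopping_time[OF st(1) fin(1)]
  note B_T1 = expectation_at_stopping_time[OF st(2) fin(2)]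
  note int = integrable_enn2real_stopping_time[OF st(1) fin(1)]
  have "expectation (\<lambda>\<omega>. max_drawdown B (enn2real (?T \<omega>)) \<omega>)
      = expectation (\<lambda>\<omega>. 2 * d + B (enn2real (?T1 \<omega>)) \<omega> - B (enn2real (?T \<omega>)) \<omega>)"
  proof (rule integral_cong_AE)
    show "AE \<omega> in M. max_drawdown B (enn2real (?T \<omega>)) \<omega>
        = 2 * d + B (enn2real (?T1 \<omega>)) \<omega> - B (enn2real (?T \<omega>)) \<omega>"
      using int(2) AE_space by eventually_elim (rule max_drawdown_at_drop_drawdown_time[OF _ d])
  qed (use measurable_max_drawdown_at_stopping_time[OF st(1)] B_T(1) B_T1(1) in auto)
  also have "\<dots> = 2 * d" using B_T B_T1 by (simp add: prob_space)
  finally show D: "expectation (\<lambda>\<omega>. max_drawdown B (enn2real (?T \<omega>)) \<omega>) = 2 * d" .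
  let ?E = "expectation (\<lambda>\<omega>. enn2real (?T \<omega>))"
  \<comment> \<open>\<open>1 / (2 * d)\<close> is the cost for which level \<open>d\<close> is
    optimal, so the general bound \<open>d + ?E / (2 * d)\<close> is sharp here.\<close>
  have "2 * d \<le> 1 / (2 * (1 / (2 * d))) + 1 / (2 * d) * ?E"
    using expectation_max_drawdown_le(2)[OF st(1) fin(1), of "1 / (2 * d)"] d unfolding D by simp
  then have "2 * d\<^sup>2 \<le> ?E"
    using d by (simp add: field_simps power2_eq_square)
  then have "ennreal (2 * d\<^sup>2) \<le> ennreal ?E" by (rule ennreal_leI)
  with T show "(\<integral>\<^sup>+\<omega>. ?T \<omega> \<partial>M) = ennreal (2 * d\<^sup>2)"
    unfolding int(3) by (rule antisym)
qed

section \<open>Payoffs and optimality\<close>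

lemma admissible_drop_drawdown_time: "0 < d \<Longrightarrow> admissible M B (drop_drawdown_time B d)"
  using stopping_time_drop_drawdown_time[of d] drop_drawdown_time_moments(1)[of d]
  by (simp add: admissible_def)

text \<open>In the drawdown bound with the same \<open>c\<close>, the term \<open>c\<close> times
  the expected time cancels against the cost.\<close>

lemma net_reward_le:
  assumes "admissible M B \<sigma>" "0 < c"
  shows "integrable M (net_reward (max_drawdown B) c \<sigma>)"
    and "expectation (net_reward (max_drawdown B) c \<sigma>) \<le> 1 / (2 * c)"
proof -
  have st: "stopping_time \<F> \<sigma>" "(\<integral>\<^sup>+\<omega>. \<sigma> \<omega> \<partial>M) < \<infinity>" using assms(1) by (auto simp: admissible_def)
  note D = expectation_max_drawdown_le[OF st assms(2)]
  note T = integrable_enn2real_stopping_time(1)[OF st]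
  show "integrable M (net_reward (max_drawdown B) c \<sigma>)"
    unfolding net_reward_def[abs_def] using D(1) T by auto
  show "expectation (net_reward (max_drawdown B) c \<sigma>) \<le> 1 / (2 * c)"
    unfolding net_reward_def[abs_def] using D T by simp
qed

lemma expectation_net_reward_drop_drawdown_time:
  assumes d: "0 < d"
  shows "expectation (net_reward (max_drawdown B) c (drop_drawdown_time B d)) = 2 * d - 2 * c * d\<^sup>2"
proof -
  have st: "stopping_time \<F> (drop_drawdown_time B d)" "(\<integral>\<^sup>+\<omega>. drop_drawdown_time B d \<omega> \<partial>M) < \<infinity>"
    using admissible_drop_drawdown_time[OF d] by (auto simp: admissible_def)
  note T = integrable_enn2real_stopping_time[OF st]
  have "ennreal (expectation (\<lambda>\<omega>. enn2real (drop_drawdown_time B d \<omega>))) = ennreal (2 * d\<^sup>2)"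
    using T(3) drop_drawdown_time_moments(1)[OF d] by simp
  then have "expectation (\<lambda>\<omega>. enn2real (drop_drawdown_time B d \<omega>)) = 2 * d\<^sup>2"
    by (subst (asm) ennreal_inj) (auto simp: integral_nonneg_AE)
  then show ?thesis
    unfolding net_reward_def[abs_def]
    \<comment> \<open>Integrability of the drawdown does not involve the cost, so it is taken from
      the bound with cost \<open>1\<close>; here \<open>c\<close> is arbitrary.\<close>
    using T(1) expectation_max_drawdown_le(1)[OF st zero_less_one] drop_drawdown_time_moments(2)[OF d]
    by simp
qed

end

theorem theorem2:
  fixes M :: "'a measure" and B :: "real \<Rightarrow> 'a \<Rightarrow> real" and c :: real
  assumes "standard_brownian_motion M B"
    and "c > 0"
  shows "c_optimal M B (max_drawdown B) c (drop_drawdown_time B (1 / (2 * c)))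
      \<and> (\<forall>d>0. c_optimal M B (max_drawdown B) c (drop_drawdown_time B d) \<longrightarrow> d = 1 / (2 * c))
      \<and> (\<integral>\<^sup>+\<omega>. drop_drawdown_time B (1 / (2 * c)) \<omega> \<partial>M) = ennreal (1 / (2 * c\<^sup>2))
      \<and> (\<integral>\<omega>. net_reward (max_drawdown B) c (drop_drawdown_time B (1 / (2 * c))) \<omega> \<partial>M) = 1 / (2 * c)"
proof -
  interpret standard_brownian_motion M B by fact
  define d0 where "d0 = 1 / (2 * c)"
  have d0: "0 < d0" "c * d0 = 1 / 2" using assms(2) by (auto simp: d0_def)
  have adm: "admissible M B (drop_drawdown_time B d0)" by (rule admissible_drop_drawdown_time[OF d0(1)])
  have "c * d0\<^sup>2 = c * d0 * d0" by (simp add: power2_eq_square)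
  then have payoff: "expectation (net_reward (max_drawdown B) c (drop_drawdown_time B d0)) = d0"
    unfolding expectation_net_reward_drop_drawdown_time[OF d0(1)] using d0(2) by simp
  have opt: "c_optimal M B (max_drawdown B) c (drop_drawdown_time B d0)"
    unfolding c_optimal_def payoff
    using adm net_reward_le[OF _ assms(2)] by (auto simp: d0_def)
  moreover have "d = d0" if d: "d > 0" and o: "c_optimal M B (max_drawdown B) c (drop_drawdown_time B d)" for d
  proof -
    have "d0 \<le> 2 * d - 2 * c * d\<^sup>2"
      using o adm payoff expectation_net_reward_drop_drawdown_time[OF d] unfolding c_optimal_def by metis
    \<comment> \<open>Completing the square shows that the payoff falls short of \<open>d0\<close>
      unless \<open>d = d0\<close>.\<close>
    moreover have "2 * d - 2 * c * d\<^sup>2 = d0 - 2 * c * (d - d0)\<^sup>2"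
      using assms(2) by (simp add: d0_def power2_eq_square field_simps)
    ultimately have "2 * c * (d - d0)\<^sup>2 \<le> 0" by simp
    then have "(d - d0)\<^sup>2 \<le> 0" using assms(2) by (simp add: mult_le_0_iff)
    then show ?thesis by simp
  qed
  moreover have "2 * d0\<^sup>2 = 1 / (2 * c\<^sup>2)" by (simp add: d0_def power_divide power_mult_distrib)
  then have "(\<integral>\<^sup>+\<omega>. drop_drawdown_time B d0 \<omega> \<partial>M) = ennreal (1 / (2 * c\<^sup>2))"
    using drop_drawdown_time_moments(1)[OF d0(1)] by simp
  ultimately show ?thesis using payoff unfolding d0_def by blast
qed

end
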